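(* Let $G$ be a finitely generated group of orientation-preserving $C^2$ circle diffeomorphisms having an exceptional minimal set $\Lambda$. If the action satisfies property $(\Lambda\star)$, then: (1) The set $\Lambda\cap\mathrm{NE}(G)$ is finite. (2) For each $x\in\Lambda$ not contained in the $G$-orbit of $\mathrm{NE}(G)$, the set of derivatives $\{g'(x): g\in G\}$ is unbounded. (3) The Lebesgue measure of $\Lambda$ is zero.
   Context: A Riemannian metric on $S^1$ is fixed and $g'(x)>0$ denotes the derivative of $g$ at $x$ with respect to it. An exceptional minimal set of $G$ is a nonempty closed $G$-invariant set $\Lambda\subset S^1$, minimal for inclusion among such sets, which is homeomorphic to the Cantor set. A point $x\in S^1$ is non-expandable if $g'(x)\le1$ for all $g\in G$; $\mathrm{NE}(G)$ is the set of non-expandable points. Property $(\Lambda\star)$: for every $x\in\Lambda\cap\mathrm{NE}(G)$ there exist $g_-,g_+\in G$ such that $g_+(x)=g_-(x)=x$ and, for some $\varepsilon>0$, $g_+$ has no other fixed point in $(x,x+\varepsilon)$ and $g_-$ has no other fixed point in $(x-\varepsilon,x)$. *)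

theory Defs
  imports "HOL-Analysis.Analysis" "HOL-Algebra.Bij" "HOL-Algebra.Generated_Groups"
begin

abbreviation S1 :: "complex set" where
  "S1 \<equiv> sphere 0 1"

definition C_k :: "nat \<Rightarrow> (real \<Rightarrow> real) \<Rightarrow> bool" where
  "C_k k F \<longleftrightarrow>
     (\<forall>j<k. \<forall>t. (deriv ^^ j) F differentiable (at t)) \<and> continuous_on UNIV ((deriv ^^ k) F)"

text \<open>Lifts are taken with respect to the covering \<open>cis\<close>, whose deck group is generated by
  translation by \<open>2 * pi\<close>. As \<open>cis\<close> is a smooth local diffeomorphism, a circle map is \<open>C\<^sup>k\<close>
  iff it has a \<open>C\<^sup>k\<close> lift, and a homeomorphism preserves orientation iff its lifts increase.\<close>

definition is_lift :: "(real \<Rightarrow> real) \<Rightarrow> (complex \<Rightarrow> complex) \<Rightarrow> bool" where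
  "is_lift F f \<longleftrightarrow> continuous_on UNIV F \<and> (\<forall>t. f (cis t) = cis (F t))"

definition C_k_circle_map :: "nat \<Rightarrow> (complex \<Rightarrow> complex) \<Rightarrow> bool" where
  "C_k_circle_map k f \<longleftrightarrow> (\<exists>F. is_lift F f \<and> C_k k F)"

definition orientation_preserving :: "(complex \<Rightarrow> complex) \<Rightarrow> bool" where
  "orientation_preserving f \<longleftrightarrow> (\<exists>F. is_lift F f \<and> strict_mono F)"

definition Diff_plus :: "nat \<Rightarrow> (complex \<Rightarrow> complex) set" where
  "Diff_plus k = {f \<in> Bij S1. C_k_circle_map k f \<and> C_k_circle_map k (inv_into S1 f) \<and>
     orientation_preserving f}"

text \<open>A Riemannian metric on the circle has the form \<open>m d\<theta>\<^sup>2\<close> with \<open>m\<close> smooth and positive;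
  \<open>m x\<close> is the squared length of the tangent vector \<open>\<i> * x\<close> at \<open>x\<close>. The tangent line at \<open>x\<close>
  is the set of real multiples of \<open>\<i> * x\<close> in the complex plane.\<close>

definition riemannian_metric :: "(complex \<Rightarrow> real) \<Rightarrow> bool" where
  "riemannian_metric m \<longleftrightarrow> (\<forall>x\<in>S1. m x > 0) \<and> (\<forall>k. C_k k (\<lambda>t. m (cis t)))"

definition tangent_norm :: "(complex \<Rightarrow> real) \<Rightarrow> complex \<Rightarrow> complex \<Rightarrow> real" where
  "tangent_norm m x v = sqrt (m x) * norm v"

text \<open>The curve \<open>\<lambda>s. x * cis s\<close> passes through \<open>x\<close> with velocity \<open>\<i> * x\<close>, so the
  vector derivative below is the image of this tangent vector under the differential of \<open>f\<close>.\<close>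

definition metric_deriv :: "(complex \<Rightarrow> real) \<Rightarrow> (complex \<Rightarrow> complex) \<Rightarrow> complex \<Rightarrow> real" where
  "metric_deriv m f x =
     tangent_norm m (f x) (vector_derivative (\<lambda>s. f (x * cis s)) (at 0)) /
     tangent_norm m x (\<i> * x)"

definition NE :: "(complex \<Rightarrow> real) \<Rightarrow> (complex \<Rightarrow> complex) set \<Rightarrow> complex set" where
  "NE m G = {x \<in> S1. \<forall>g\<in>G. metric_deriv m g x \<le> 1}"

definition finitely_generated :: "('a, 'b) monoid_scheme \<Rightarrow> 'a set \<Rightarrow> bool" where
  "finitely_generated K G \<longleftrightarrow> (\<exists>S. finite S \<and> S \<subseteq> carrier K \<and> G = generate K S)"

definition cantor_set :: "real set" where
  "cantor_set = (\<Inter>n. ((\<lambda>A. (\<lambda>x. x / 3) ` A \<union> (\<lambda>x. (x + 2) / 3) ` A) ^^ n) {0..1})"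

definition closed_invariant :: "(complex \<Rightarrow> complex) set \<Rightarrow> complex set \<Rightarrow> bool" where
  "closed_invariant G A \<longleftrightarrow> A \<noteq> {} \<and> A \<subseteq> S1 \<and> closed A \<and> (\<forall>g\<in>G. g ` A = A)"

definition exceptional_minimal_set :: "(complex \<Rightarrow> complex) set \<Rightarrow> complex set \<Rightarrow> bool" where
  "exceptional_minimal_set G A \<longleftrightarrow>
     closed_invariant G A \<and> (\<forall>B. closed_invariant G B \<and> B \<subseteq> A \<longrightarrow> B = A) \<and>
     A homeomorphic cantor_set"

definition property_Lambda_star ::
    "(complex \<Rightarrow> real) \<Rightarrow> (complex \<Rightarrow> complex) set \<Rightarrow> complex set \<Rightarrow> bool" where
  "property_Lambda_star m G A \<longleftrightarrow>
     (\<forall>x \<in> A \<inter> NE m G. \<exists>g_minus\<in>G. \<exists>g_plus\<in>G.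
        g_plus x = x \<and> g_minus x = x \<and>
        (\<exists>\<epsilon>>0. (\<forall>s\<in>{0<..<\<epsilon>}. g_plus (x * cis s) \<noteq> x * cis s) \<and>
                (\<forall>s\<in>{0<..<\<epsilon>}. g_minus (x * cis (- s)) \<noteq> x * cis (- s))))"

text \<open>Not normalised: the total mass is \<open>2 * pi\<close>.\<close>

definition circle_lebesgue :: "complex measure" where
  "circle_lebesgue = distr (restrict_space lborel {0..<2 * pi}) borel cis"

end

theory Submission
  imports Defs
begin

text \<open>Work on the real line with all lifts of elements of \<open>G\<close>. Near a non-expandable point \<open>x\<close> of \<open>\<Lambda>\<close>
  the one-sided fixed-point-free stabilisers given by \<open>(\<Lambda>\<star>)\<close> have iterates that expand by an
  arbitrary factor, with distortion controlled as in Denjoy's theorem. Hence non-expandable points are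
  isolated in \<open>\<Lambda>\<close>, and by compactness every other point of \<open>\<Lambda>\<close> is expanded by a uniform
  factor with uniform distortion on a ball of uniform size. Iterating, points outside the orbit of
  \<open>NE\<close> have unbounded derivatives, and small neighbourhoods of them are blown up to a fixed size
  with bounded distortion. As \<open>\<Lambda>\<close> has uniform gaps at the fixed size, it is porous at these points;
  the remaining points form a countable set, so \<open>\<Lambda>\<close> has measure zero.\<close>

section \<open>Distortion near a parabolic fixed point\<close>

text \<open>An element of \<open>G\<close> has factor at most 1 at a non-expandable point, hence
  hardly more than 1 close to it, so no single element expands uniformly there. The number of
  iterates needed grows without bound as the point is approached, and distortion must be bounded
  independently of that number. Denjoy's sum gives such a bound on a ball of fixed radius about the
  preimage \<open>y\<close>, not about the point itself. This is why everything is phrased with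
  contracting inverse branches \<open>h\<close>, \<open>h y = x\<close>: composing them sends a
  fixed ball through smaller and smaller ones, and their distortions can be added up. The
  \<open>C^2\<close> hypothesis enters as a Lipschitz bound for the logarithm of the derivative. The
  metric enters as a positive periodic weight with bounded ratios, so metric and ordinary
  derivatives agree up to a fixed factor and distortion can be measured for the ordinary ones. The
  exceptional points of \<open>\<Lambda>\<close> are countable since \<open>G\<close>, being
  finitely generated, is countable and \<open>\<Lambda> \<inter> NE m G\<close> is finite.\<close>

lemma mean_value_closed_segment:
  fixes f f' :: "real \<Rightarrow> real"
  assumes "\<And>t. (f has_real_derivative f' t) (at t)"
  obtains z where "z \<in> closed_segment p q" "f q - f p = f' z * (q - p)"
proof -
  consider "p < q" | "q < p" | "p = q" by linarith
  then show thesis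
  proof cases
    case 1
    then obtain z where "p < z" "z < q" "f q - f p = (q - p) * f' z"
      using MVT2[of p q f f'] assms by blast
    with 1 that[of z] show ?thesis by (simp add: closed_segment_eq_real_ivl mult.commute)
  next
    case 2
    then obtain z where "q < z" "z < p" "f p - f q = (p - q) * f' z"
      using MVT2[of q p f f'] assms by blast
    with 2 that[of z] show ?thesis by (simp add: closed_segment_eq_real_ivl algebra_simps)
  next
    case 3
    with that[of p] show ?thesis by simp
  qed
qed

lemma le_exp_mult_of_ln_diff_le:
  fixes a b c :: real
  assumes "a > 0" "b > 0" "ln a - ln b \<le> c"
  shows "a \<le> exp c * b"
proof -
  have "a / b = exp (ln a - ln b)" using assms by (simp add: exp_diff)
  also have "\<dots> \<le> exp c" using assms by simp
  finally show ?thesis using assms by (simp add: field_simps)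
qed

text \<open>The scale \<open>e\<close> is both the radius of a neighbourhood and the parameter of
  \<open>P\<close>, so the least radius of a finite subcover serves in both roles. Applied to
  expansion steps and to gaps.\<close>

lemma compact_uniform_radius:
  fixes K :: "'a::metric_space set"
  assumes "compact K"
    and mono: "\<And>d e x. P e x \<Longrightarrow> 0 < d \<Longrightarrow> d \<le> e \<Longrightarrow> P d x"
    and loc: "\<And>x. x \<in> K \<Longrightarrow> \<exists>e>0. \<forall>t\<in>ball x e. P e t"
  shows "\<exists>e>0. \<forall>x\<in>K. P (e::real) x"
proof -
  obtain r where r: "\<And>x. x \<in> K \<Longrightarrow> r x > 0 \<and> (\<forall>t\<in>ball x (r x). P (r x) t)"
    using loc by metis
  have "K \<subseteq> (\<Union>x\<in>K. ball x (r x))" using r by force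
  then obtain C where C: "C \<subseteq> K" "finite C" "K \<subseteq> (\<Union>x\<in>C. ball x (r x))"
    using compactE_image[OF assms(1), of K "\<lambda>x. ball x (r x)"] by blast
  show ?thesis
  proof (cases "C = {}")
    case True
    with C show ?thesis by (auto intro: exI[of _ 1])
  next
    case False
    define e where "e = Min (r ` C)"
    have "e > 0" using C r False by (auto simp: e_def subset_iff)
    moreover have "P e x" if x: "x \<in> K" for x
    proof -
      obtain c where "c \<in> C" "x \<in> ball c (r c)" using C x by blast
      moreover have "e \<le> r c" using \<open>c \<in> C\<close> C by (auto simp: e_def)
      ultimately show ?thesis using mono r C \<open>e > 0\<close> by blast
    qed
    ultimately show ?thesis by blast
  qed
qed

text \<open>Passing from \<open>k\<close> to \<open>k + 1\<close> adds one telescoping sum, which is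
  at most \<open>c 0 - a\<close>.\<close>

lemma sum_telescope_shift_le:
  fixes c :: "nat \<Rightarrow> real"
  assumes "decseq c" "\<And>n. a \<le> c n"
  shows "(\<Sum>i<n. c i - c (i + k)) \<le> real k * (c 0 - a)"
proof -
  have "(\<Sum>i<n. c i - c (i + k)) \<le> real k * (c 0 - a)" for n
  proof (induction k)
    case (Suc k)
    have "(\<Sum>i<n. c i - c (i + Suc k)) = (\<Sum>i<n. c i - c (i + k)) + (\<Sum>i<n. c (i + k) - c (Suc i + k))"
      by (simp add: sum.distrib[symmetric])
    also have "(\<Sum>i<n. c (i + k) - c (Suc i + k)) = c k - c (n + k)"
      using sum_lessThan_telescope'[of "\<lambda>i. c (i + k)" n] by simp
    also have "\<dots> \<le> c 0 - a"
      using assms(2)[of "n + k"] decseqD[OF assms(1), of 0 k] by simp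
    finally show ?case using Suc by (simp add: algebra_simps)
  qed simp
  then show ?thesis .
qed

lemma funpow_has_real_derivative:
  fixes h h' :: "real \<Rightarrow> real"
  assumes "\<And>t. (h has_real_derivative h' t) (at t)"
  shows "((h ^^ n) has_real_derivative (\<Prod>i<n. h' ((h ^^ i) t))) (at t)"
proof (induction n)
  case 0
  then show ?case by (simp add: id_def)
next
  case (Suc n)
  have "((\<lambda>x. h ((h ^^ n) x)) has_real_derivative h' ((h ^^ n) t) * (\<Prod>i<n. h' ((h ^^ i) t))) (at t)"
    using DERIV_chain2[OF assms Suc] .
  then show ?case by (simp add: o_def mult.commute)
qed

text \<open>Denjoy's argument: with \<open>c\<^sub>n = h\<^sup>n b\<close>, the images \<open>[c\<^sub>i\<^sub>+\<^sub>3, c\<^sub>i]\<close> of three adjacent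
  fundamental domains overlap at most threefold, so their lengths have a finite sum. A point near
  \<open>x\<close> is the image under some \<open>h\<^sup>n\<close> of a point of the middle domain.\<close>

lemma parabolic_right:
  fixes h h' :: "real \<Rightarrow> real"
  assumes der: "\<And>t. (h has_real_derivative h' t) (at t)"
    and pos: "\<And>t. h' t > 0"
    and lip: "\<And>u v. \<bar>ln (h' u) - ln (h' v)\<bar> \<le> K * \<bar>u - v\<bar>"
    and fixed: "h x = x" and "\<epsilon> > 0"
    and below: "\<And>t. x < t \<Longrightarrow> t < x + \<epsilon> \<Longrightarrow> h t < t"
    and "\<eta> > 0"
  shows "\<exists>e>0. \<forall>t\<in>{x<..<x + e}. \<exists>n y. (h ^^ n) y = t \<and> deriv (h ^^ n) y \<le> \<eta> \<and>
           (\<forall>p\<in>cball y e. \<forall>q\<in>cball y e.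
              \<bar>ln (deriv (h ^^ n) p) - ln (deriv (h ^^ n) q)\<bar> \<le> \<bar>p - q\<bar> / e)"
proof -
  define D where "D n t = (\<Prod>i<n. h' ((h ^^ i) t))" for n t
  have Dder: "((h ^^ n) has_real_derivative D n t) (at t)" for n t
    unfolding D_def by (rule funpow_has_real_derivative[OF der])
  have Dpos: "D n t > 0" for n t
    unfolding D_def by (intro prod_pos) (auto intro: pos)
  have hmono: "h s < h t" if "s < t" for s t
    by (rule DERIV_pos_imp_increasing[OF that]) (use der pos in blast)
  have hnmono: "(h ^^ n) s < (h ^^ n) t" if "s < t" for s t n
    by (induction n) (auto simp: that hmono)
  have hnmono_le: "(h ^^ n) s \<le> (h ^^ n) t" if "s \<le> t" for s t n
    using hnmono[of s t n] that by (cases "s = t") auto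
  \<comment> \<open>Any starting point strictly inside the interval where \<open>h\<close> moves
    points down would do.\<close>
  define b where "b = x + \<epsilon> / 2"
  define c where "c n = (h ^^ n) b" for n
  have b: "x < b" "b < x + \<epsilon>" using \<open>\<epsilon> > 0\<close> by (auto simp: b_def)
  have cgt: "x < c n" for n
  proof (induction n)
    case (Suc n) then show ?case using hmono[OF Suc] fixed by (simp add: c_def)
  qed (simp add: c_def b)
  have cSuc: "c (Suc n) < c n \<and> c n < x + \<epsilon>" for n
  proof (induction n)
    case 0 show ?case using b below by (simp add: c_def)
  next
    case (Suc n)
    then have "c (Suc n) < x + \<epsilon>" by linarith
    moreover have "h (c (Suc n)) < c (Suc n)" using below[OF cgt] calculation by blast
    ultimately show ?case by (simp add: c_def)
  qed
  have cdec: "decseq c" by (rule decseq_SucI) (use cSuc less_imp_le in blast)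
  have cless: "c j < c i" if "i < j" for i j
    using decseqD[OF cdec, of "Suc i" j] cSuc[of i] that by (simp add: Suc_leI)
  \<comment> \<open>The limit is a fixed point of \<open>h\<close> in
    \<open>[x, x + \<epsilon>)\<close>, and \<open>below\<close> leaves only
    \<open>x\<close>.\<close>
  have clim: "c \<longlonglongrightarrow> x"
  proof -
    obtain l where l: "c \<longlonglongrightarrow> l" "\<And>n. l \<le> c n"
      using decseq_convergent[OF cdec, of x] cgt less_imp_le by metis
    have "isCont h l" using der DERIV_isCont by blast
    then have "(\<lambda>n. h (c n)) \<longlonglongrightarrow> h l" using l(1) isCont_tendsto_compose by blast
    moreover have "(\<lambda>n. h (c n)) = (\<lambda>n. c (Suc n))" by (simp add: c_def)
    ultimately have "h l = l" using LIMSEQ_unique LIMSEQ_Suc[OF l(1)] by metis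
    moreover have "x \<le> l" using LIMSEQ_le_const[OF l(1)] cgt less_imp_le by blast
    moreover have "l < x + \<epsilon>" using l(2)[of 0] cSuc[of 0] by linarith
    ultimately have "l = x" using below[of l] by fastforce
    then show ?thesis using l by simp
  qed
  have K: "K \<ge> 0" using lip[of 0 1] by simp
  \<comment> \<open>The outer two domains leave room for a ball about any point of the middle one,
    \<open>[c 2, c 1]\<close>.\<close>
  define J where "J = {c 3..c 0}"
  define S where "S = 3 * (c 0 - x)"
  define E where "E = exp (K * S)"
  have len: "c 3 < c 0" by (rule cless) simp
  have Spos: "S > 0" using cgt[of 0] by (simp add: S_def)
  have Esum: "(\<Sum>i<n. c i - c (i + 3)) \<le> S" for n
  proof -
    have "(\<Sum>i<n. c i - c (i + 3)) \<le> real 3 * (c 0 - x)"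
      by (rule sum_telescope_shift_le[OF cdec less_imp_le[OF cgt]])
    then show ?thesis by (simp add: S_def)
  qed
  have Jsub: "(h ^^ i) p \<in> {c (i + 3)..c i}" if "p \<in> J" for i p
  proof -
    have "(h ^^ i) (c j) = c (i + j)" for j by (simp add: c_def funpow_add)
    from this[of 3] this[of 0] show ?thesis
      using hnmono_le[of "c 3" p i] hnmono_le[of p "c 0" i] that by (auto simp: J_def)
  qed
  have lnD: "ln (D n p) = (\<Sum>i<n. ln (h' ((h ^^ i) p)))" for n p
    unfolding D_def by (rule ln_prod) (auto simp: pos less_imp_neq[symmetric])
  have dist1: "\<bar>ln (D n p) - ln (D n q)\<bar> \<le> K * (\<Sum>i<n. \<bar>(h ^^ i) p - (h ^^ i) q\<bar>)" for n p q
  proof -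
    have "\<bar>ln (D n p) - ln (D n q)\<bar> \<le> (\<Sum>i<n. \<bar>ln (h' ((h ^^ i) p)) - ln (h' ((h ^^ i) q))\<bar>)"
      unfolding lnD sum_subtractf[symmetric] by (rule sum_abs)
    also have "\<dots> \<le> (\<Sum>i<n. K * \<bar>(h ^^ i) p - (h ^^ i) q\<bar>)" by (intro sum_mono lip)
    finally show ?thesis by (simp add: sum_distrib_left)
  qed
  have dist2: "D n p \<le> E * D n q" if "p \<in> J" "q \<in> J" for n p q
  proof -
    have "(\<Sum>i<n. \<bar>(h ^^ i) p - (h ^^ i) q\<bar>) \<le> (\<Sum>i<n. c i - c (i + 3))"
    proof (rule sum_mono)
      fix i
      show "\<bar>(h ^^ i) p - (h ^^ i) q\<bar> \<le> c i - c (i + 3)"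
        using Jsub[of p i] Jsub[of q i] that by auto
    qed
    then have "(\<Sum>i<n. \<bar>(h ^^ i) p - (h ^^ i) q\<bar>) \<le> S" using Esum order_trans by blast
    then have "ln (D n p) - ln (D n q) \<le> K * S"
      using dist1[of n p q] mult_left_mono[OF _ K] by fastforce
    then show ?thesis unfolding E_def by (rule le_exp_mult_of_ln_diff_le[OF Dpos Dpos])
  qed
  \<comment> \<open>The derivative equals the ratio of lengths at one point of \<open>J\<close>;
    \<open>dist2\<close> transfers this to every point at the cost of the factor
    \<open>E\<close>.\<close>
  have Dlen: "D n p \<le> E * ((c n - c (n + 3)) / (c 0 - c 3))" if p: "p \<in> J" for n p
  proof -
    obtain z where z: "z \<in> closed_segment (c 3) (c 0)"
      and "(h ^^ n) (c 0) - (h ^^ n) (c 3) = D n z * (c 0 - c 3)"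
      by (rule mean_value_closed_segment[OF Dder, of "c 3" "c 0" n])
    then have "D n z = (c n - c (n + 3)) / (c 0 - c 3)"
      using len by (simp add: c_def funpow_add)
    moreover have "z \<in> J" using z len by (simp add: J_def closed_segment_eq_real_ivl)
    ultimately show ?thesis using dist2[OF p, of z n] by simp
  qed
  define C where "C = K * (E * S / (c 0 - c 3))"
  have C: "C \<ge> 0" using K Spos len by (simp add: C_def E_def)
  \<comment> \<open>Second pass through the distortion sum: \<open>Dlen\<close> bounds the distance
    of the \<open>i\<close>-th images by a multiple of
    \<open>(c i - c (i + 3)) * \<bar>p - q\<bar>\<close>. Summing improves the constant bound to a
    Lipschitz bound with \<open>C\<close> independent of \<open>n\<close>.\<close>
  have dist3: "\<bar>ln (D n p) - ln (D n q)\<bar> \<le> C * \<bar>p - q\<bar>" if p: "p \<in> J" and q: "q \<in> J" for n p q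
  proof -
    have *: "\<bar>(h ^^ i) p - (h ^^ i) q\<bar> \<le> (c i - c (i + 3)) * (E / (c 0 - c 3) * \<bar>p - q\<bar>)" for i
    proof -
      obtain z where z: "z \<in> closed_segment q p"
        and eq: "(h ^^ i) p - (h ^^ i) q = D i z * (p - q)"
        by (rule mean_value_closed_segment[OF Dder, of q p i])
      have "z \<in> J" using z p q by (auto simp: J_def closed_segment_eq_real_ivl split: if_splits)
      then have "\<bar>D i z\<bar> \<le> E * ((c i - c (i + 3)) / (c 0 - c 3))"
        using Dlen[of z i] Dpos[of i z] by simp
      then have "\<bar>D i z\<bar> * \<bar>p - q\<bar> \<le> E * ((c i - c (i + 3)) / (c 0 - c 3)) * \<bar>p - q\<bar>"
        by (rule mult_right_mono) simp
      then show ?thesis unfolding eq abs_mult by (simp add: algebra_simps)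
    qed
    have "(\<Sum>i<n. \<bar>(h ^^ i) p - (h ^^ i) q\<bar>)
        \<le> (\<Sum>i<n. (c i - c (i + 3)) * (E / (c 0 - c 3) * \<bar>p - q\<bar>))"
      by (intro sum_mono *)
    also have "\<dots> = (\<Sum>i<n. c i - c (i + 3)) * (E / (c 0 - c 3) * \<bar>p - q\<bar>)"
      by (rule sum_distrib_right[symmetric])
    also have "\<dots> \<le> S * (E / (c 0 - c 3) * \<bar>p - q\<bar>)"
      by (intro mult_right_mono Esum) (use len in \<open>simp add: E_def\<close>)
    finally have "K * (\<Sum>i<n. \<bar>(h ^^ i) p - (h ^^ i) q\<bar>) \<le> K * (S * (E / (c 0 - c 3) * \<bar>p - q\<bar>))"
      using K mult_left_mono by blast
    also have "\<dots> = C * \<bar>p - q\<bar>" by (simp add: C_def)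
    finally show ?thesis using dist1[of n p q] by linarith
  qed
  \<comment> \<open>Solves \<open>E * (\<zeta> / (c 0 - c 3)) = \<eta>\<close>: by
    \<open>Dlen\<close>, derivatives on \<open>J\<close> drop to \<open>\<eta>\<close> as soon as
    \<open>c n\<close> is within \<open>\<zeta>\<close> of \<open>x\<close>.\<close>
  define \<zeta> where "\<zeta> = \<eta> * (c 0 - c 3) / E"
  have "\<zeta> > 0" using \<open>\<eta> > 0\<close> len by (simp add: \<zeta>_def E_def)
  then obtain m where m: "c m < x + \<zeta>"
    using order_tendstoD(2)[OF clim, of "x + \<zeta>"] eventually_sequentially by auto
  \<comment> \<open>The entries in order: the first forces \<open>m \<le> n\<close>; the next two
    keep the ball about a point of \<open>[c 2, c 1]\<close> inside \<open>J\<close>; the fourth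
    gives \<open>C \<le> 1 / e\<close>; the last puts \<open>t\<close> below \<open>c 2\<close>,
    which is needed when \<open>n = 0\<close>.\<close>
  define e where "e = Min {c (Suc m) - x, c 2 - c 3, c 0 - c 1, 1 / (C + 1), c 2 - x}"
  have e: "e > 0" "e \<le> c (Suc m) - x" "e \<le> c 2 - c 3" "e \<le> c 0 - c 1" "e \<le> 1 / (C + 1)" "e \<le> c 2 - x"
    using cgt cless[of 2 3] cless[of 0 1] C by (auto simp: e_def)
  have "C \<le> 1 / e" using e(1,5) C by (simp add: field_simps)
  have "\<exists>n y. (h ^^ n) y = t \<and> deriv (h ^^ n) y \<le> \<eta> \<and>
           (\<forall>p\<in>cball y e. \<forall>q\<in>cball y e.
              \<bar>ln (deriv (h ^^ n) p) - ln (deriv (h ^^ n) q)\<bar> \<le> \<bar>p - q\<bar> / e)"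
    if t: "t \<in> {x<..<x + e}" for t
  proof -
    have "\<exists>n. c (n + 2) < t"
      using order_tendstoD(2)[OF LIMSEQ_ignore_initial_segment[OF clim, of 2], of t] t
        eventually_sequentially by auto
    \<comment> \<open>Minimality gives \<open>c (n + 2) < t \<le> c (n + 1)\<close>, so
      \<open>t\<close> lies in the image under \<open>h ^^ n\<close> of the middle domain.\<close>
    define n where "n = (LEAST n. c (n + 2) < t)"
    have n1: "c (n + 2) < t" unfolding n_def by (rule LeastI_ex) fact
    have n2: "t \<le> c (n + 1)"
    proof (cases n)
      case 0
      then show ?thesis using t e(6) cless[of 1 2] by simp
    next
      case (Suc k)
      then have "\<not> c (k + 2) < t" using not_less_Least[of k "\<lambda>n. c (n + 2) < t"] n_def by simp
      then show ?thesis using Suc by simp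
    qed
    have "m \<le> n"
    proof (rule ccontr)
      assume "\<not> m \<le> n"
      then have "c (Suc m) \<le> c (n + 2)" by (intro decseqD[OF cdec]) simp
      then show False using n1 t e(2) by auto
    qed
    have hc: "(h ^^ n) (c j) = c (n + j)" for j by (simp add: c_def funpow_add)
    have "continuous_on {c 2..c 1} (h ^^ n)"
      using Dder DERIV_isCont continuous_at_imp_continuous_on by blast
    then obtain y where y: "c 2 \<le> y" "y \<le> c 1" "(h ^^ n) y = t"
      using IVT'[of "h ^^ n" "c 2" t "c 1"] n1 n2 hc cless[of 1 2] by (auto simp: less_imp_le)
    have ball: "cball y e \<subseteq> J" using e y by (auto simp: J_def dist_real_def)
    have "y \<in> J" using ball e(1) by auto
    have "D n y \<le> E * ((c n - c (n + 3)) / (c 0 - c 3))" by (rule Dlen) fact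
    also have "\<dots> \<le> E * (\<zeta> / (c 0 - c 3))"
    proof (intro mult_left_mono divide_right_mono)
      show "c n - c (n + 3) \<le> \<zeta>"
        using m decseqD[OF cdec \<open>m \<le> n\<close>] cgt[of "n + 3"] by linarith
    qed (use len in \<open>auto simp: E_def\<close>)
    also have "\<dots> = \<eta>" using len by (simp add: \<zeta>_def E_def)
    finally have "D n y \<le> \<eta>" .
    moreover have "\<bar>ln (D n p) - ln (D n q)\<bar> \<le> \<bar>p - q\<bar> / e" if "p \<in> cball y e" "q \<in> cball y e" for p q
    proof -
      have "\<bar>ln (D n p) - ln (D n q)\<bar> \<le> C * \<bar>p - q\<bar>" using dist3 that ball by blast
      also have "\<dots> \<le> 1 / e * \<bar>p - q\<bar>" by (rule mult_right_mono) (auto simp: \<open>C \<le> 1 / e\<close>)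
      finally show ?thesis by simp
    qed
    moreover have "deriv (h ^^ n) = D n" using DERIV_imp_deriv[OF Dder] by blast
    ultimately show ?thesis using y(3) by force
  qed
  with e(1) show ?thesis by blast
qed

text \<open>Conjugation by \<open>t \<mapsto> - t\<close> exchanges the two sides of the fixed point
  and reduces this to \<open>parabolic_right\<close>.\<close>

lemma parabolic_left:
  fixes h h' :: "real \<Rightarrow> real"
  assumes der: "\<And>t. (h has_real_derivative h' t) (at t)"
    and pos: "\<And>t. h' t > 0"
    and lip: "\<And>u v. \<bar>ln (h' u) - ln (h' v)\<bar> \<le> K * \<bar>u - v\<bar>"
    and fixed: "h x = x" and "\<epsilon> > 0"
    and above: "\<And>t. x - \<epsilon> < t \<Longrightarrow> t < x \<Longrightarrow> t < h t"
    and "\<eta> > 0"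
  shows "\<exists>e>0. \<forall>t\<in>{x - e<..<x}. \<exists>n y. (h ^^ n) y = t \<and> deriv (h ^^ n) y \<le> \<eta> \<and>
           (\<forall>p\<in>cball y e. \<forall>q\<in>cball y e.
              \<bar>ln (deriv (h ^^ n) p) - ln (deriv (h ^^ n) q)\<bar> \<le> \<bar>p - q\<bar> / e)"
proof -
  define k where "k t = - h (- t)" for t
  have kn: "(k ^^ n) t = - (h ^^ n) (- t)" for n t
    by (induction n) (auto simp: k_def)
  have der_hn: "((h ^^ n) has_real_derivative deriv (h ^^ n) t) (at t)" for n t
    using funpow_has_real_derivative[OF der, of n t] DERIV_imp_deriv by metis
  have "deriv (k ^^ n) t = deriv (h ^^ n) (- t)" for n t
  proof (rule DERIV_imp_deriv)
    have "((\<lambda>t. - (h ^^ n) (- t)) has_real_derivative deriv (h ^^ n) (- t)) (at t)"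
      by (auto intro!: derivative_eq_intros DERIV_chain2[OF der_hn])
    then show "((k ^^ n) has_real_derivative deriv (h ^^ n) (- t)) (at t)"
      by (simp add: kn[abs_def])
  qed
  note dk = this
  have "(k has_real_derivative h' (- t)) (at t)" for t
    unfolding k_def by (auto intro!: derivative_eq_intros DERIV_chain2[OF der])
  moreover have "\<bar>ln (h' (- u)) - ln (h' (- v))\<bar> \<le> K * \<bar>u - v\<bar>" for u v
    using lip[of "- u" "- v"] by (simp add: abs_minus_commute)
  moreover have "k t < t" if "- x < t" "t < - x + \<epsilon>" for t
    using above[of "- t"] that by (simp add: k_def)
  ultimately obtain e where e: "e > 0" and
    *: "\<And>t. t \<in> {- x<..<- x + e} \<Longrightarrow> \<exists>n y. (k ^^ n) y = t \<and> deriv (k ^^ n) y \<le> \<eta> \<and>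
           (\<forall>p\<in>cball y e. \<forall>q\<in>cball y e.
              \<bar>ln (deriv (k ^^ n) p) - ln (deriv (k ^^ n) q)\<bar> \<le> \<bar>p - q\<bar> / e)"
    using parabolic_right[of k "\<lambda>t. h' (- t)" K "- x" \<epsilon> \<eta>] pos fixed \<open>\<epsilon> > 0\<close> \<open>\<eta> > 0\<close>
    unfolding k_def by auto
  show ?thesis
  proof (intro exI[of _ e] conjI ballI e)
    fix t assume "t \<in> {x - e<..<x}"
    then obtain n y where y: "(k ^^ n) y = - t" "deriv (k ^^ n) y \<le> \<eta>"
      "\<And>p q. p \<in> cball y e \<Longrightarrow> q \<in> cball y e \<Longrightarrow>
              \<bar>ln (deriv (k ^^ n) p) - ln (deriv (k ^^ n) q)\<bar> \<le> \<bar>p - q\<bar> / e"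
      using *[of "- t"] by auto
    have "(h ^^ n) (- y) = t" using y(1) kn by simp
    moreover have "deriv (h ^^ n) (- y) \<le> \<eta>" using y(2) dk by simp
    moreover have "\<bar>ln (deriv (h ^^ n) p) - ln (deriv (h ^^ n) q)\<bar> \<le> \<bar>p - q\<bar> / e"
      if "p \<in> cball (- y) e" "q \<in> cball (- y) e" for p q
      using y(3)[of "- p" "- q"] that dk by (simp add: dist_real_def abs_minus_commute algebra_simps)
    ultimately show "\<exists>n y. (h ^^ n) y = t \<and> deriv (h ^^ n) y \<le> \<eta> \<and>
           (\<forall>p\<in>cball y e. \<forall>q\<in>cball y e.
              \<bar>ln (deriv (h ^^ n) p) - ln (deriv (h ^^ n) q)\<bar> \<le> \<bar>p - q\<bar> / e)"
      by blast
  qed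
qed

section \<open>Porous sets\<close>

text \<open>If \<open>U\<close> is an open set slightly larger than \<open>S\<close>, the holes of a Vitali family of balls in \<open>U\<close>
  fit into \<open>U - S\<close> but carry a fixed proportion of the measure of \<open>S\<close>.\<close>

lemma porous_negligible:
  fixes S :: "'a::euclidean_space set"
  assumes S: "S \<in> lmeasurable" and "c > 0"
    and porous: "\<And>x r. x \<in> S \<Longrightarrow> r > 0 \<Longrightarrow>
      \<exists>d z. 0 < d \<and> d < r \<and> ball z (c * d) \<subseteq> ball x d - S"
  shows "negligible S"
proof -
  have bound: "ennreal (c ^ DIM('a)) * emeasure lebesgue S \<le> ennreal e" if "e > 0" for e
  proof -
    obtain U where U: "open U" "S \<subseteq> U" "U - S \<in> lmeasurable" "emeasure lebesgue (U - S) < ennreal e"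
      using sets_lebesgue_outer_open[of S e] S \<open>e > 0\<close> by (auto simp: fmeasurable_def)
    \<comment> \<open>Each index carries its hole along with its ball, so the Vitali theorem selects
      disjoint balls together with disjoint holes.\<close>
    define I where "I = {(x, d, z). x \<in> S \<and> 0 < d \<and> ball x d \<subseteq> U \<and> ball z (c * d) \<subseteq> ball x d - S}"
    define B where "B i = ball (fst i) (fst (snd i))" for i :: "'a \<times> real \<times> 'a"
    define Z where "Z i = ball (snd (snd i)) (c * fst (snd i))" for i :: "'a \<times> real \<times> 'a"
    have cover: "\<exists>i. i \<in> I \<and> x \<in> B i \<and> fst (snd i) < r"
      if "x \<in> S" "r > 0" for x r
    proof -
      obtain k where "k > 0" "ball x k \<subseteq> U" using U \<open>x \<in> S\<close> open_contains_ball by blast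
      obtain d z where d: "0 < d" "d < min r k" "ball z (c * d) \<subseteq> ball x d - S"
        using porous[of x "min r k"] \<open>x \<in> S\<close> \<open>r > 0\<close> \<open>k > 0\<close> by auto
      then have "ball x d \<subseteq> U" using \<open>ball x k \<subseteq> U\<close> by (meson less_imp_le min_less_iff_conj order_trans subset_ball)
      then show ?thesis using d \<open>x \<in> S\<close> by (intro exI[of _ "(x, d, z)"]) (auto simp: I_def B_def)
    qed
    obtain C where C: "countable C" "C \<subseteq> I"
        "pairwise (\<lambda>i j. disjnt (B i) (B j)) C"
        "negligible (S - (\<Union>i\<in>C. B i))"
      by (rule Vitali_covering_theorem_balls[of S I fst "\<lambda>i. fst (snd i)", folded B_def, OF cover])
    have ZB: "Z i \<subseteq> B i - S" "B i \<subseteq> U" "fst (snd i) > 0" if "i \<in> C" for i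
      using subsetD[OF C(2) that] by (simp_all add: I_def Z_def B_def case_prod_beta)
    have disjB: "disjoint_family_on B C"
      using C(3) by (auto simp: disjoint_family_on_def pairwise_def disjnt_def)
    have disjZ: "disjoint_family_on Z C"
      using disjB ZB(1) unfolding disjoint_family_on_def by blast
    have meas: "B i \<in> sets lebesgue" "Z i \<in> sets lebesgue" for i
      by (auto simp: B_def Z_def)
    have Un: "(\<Union>i\<in>C. B i) \<in> sets lebesgue" "(\<Union>i\<in>C. Z i) \<in> sets lebesgue"
      using C(1) meas by (auto intro: sets.countable_UN')
    have scale: "emeasure lebesgue (Z i) = ennreal (c ^ DIM('a)) * emeasure lebesgue (B i)" if "i \<in> C" for i
      using ZB(3)[OF that] \<open>c > 0\<close>
      by (simp add: Z_def B_def emeasure_ball main_part_sets power_mult_distrib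
          ennreal_mult[symmetric] unit_ball_vol_nonneg mult_ac)
    have "emeasure lebesgue S \<le> emeasure lebesgue ((S - (\<Union>i\<in>C. B i)) \<union> (\<Union>i\<in>C. B i))"
      by (rule emeasure_mono) (use S Un in \<open>auto simp: fmeasurable_def\<close>)
    also have "\<dots> = emeasure lebesgue (\<Union>i\<in>C. B i)"
      unfolding Un_commute[of "S - _"] using C(4) Un
      by (intro emeasure_Un_null_set) (auto simp: negligible_iff_null_sets)
    also have "\<dots> = (\<integral>\<^sup>+i. emeasure lebesgue (B i) \<partial>count_space C)"
      by (rule emeasure_UN_countable[OF _ C(1) disjB]) (rule meas)
    finally have "ennreal (c ^ DIM('a)) * emeasure lebesgue S
        \<le> ennreal (c ^ DIM('a)) * (\<integral>\<^sup>+i. emeasure lebesgue (B i) \<partial>count_space C)"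
      by (rule mult_left_mono) simp
    also have "\<dots> = (\<integral>\<^sup>+i. emeasure lebesgue (Z i) \<partial>count_space C)"
      by (subst nn_integral_cmult[symmetric]) (auto intro!: nn_integral_cong simp: scale)
    also have "\<dots> = emeasure lebesgue (\<Union>i\<in>C. Z i)"
      by (rule emeasure_UN_countable[OF _ C(1) disjZ, symmetric]) (rule meas)
    also have "\<dots> \<le> emeasure lebesgue (U - S)"
      by (rule emeasure_mono) (use ZB U(3) in \<open>blast intro: fmeasurableD\<close>)+
    finally show ?thesis using U(4) by simp
  qed
  have "ennreal (c ^ DIM('a)) * emeasure lebesgue S \<le> 0"
    by (rule ennreal_le_epsilon) (simp add: bound)
  then have "emeasure lebesgue S = 0" using \<open>c > 0\<close> by simp
  then show ?thesis using S by (auto simp: negligible_iff_null_sets null_sets_def fmeasurable_def)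
qed

section \<open>Expansion for groups of lifts\<close>

lemma reduce_mod_2pi:
  fixes t :: real
  obtains k :: int where "t + 2 * pi * of_int k \<in> {0..<2 * pi}"
proof
  show "t + 2 * pi * of_int (- \<lfloor>t / (2 * pi)\<rfloor>) \<in> {0..<2 * pi}"
    using floor_divide_lower[of "2 * pi" t] floor_divide_upper[of "2 * pi" t]
    by (auto simp: algebra_simps)
qed

text \<open>To be instantiated with \<open>\<Gamma>\<close> the group of all lifts of elements of
  \<open>G\<close>, \<open>w\<close> the length of the unit angular vector at \<open>cis t\<close>,
  and \<open>L\<close> the preimage of \<open>\<Lambda>\<close> under \<open>cis\<close>. The
  topology of the Cantor set is present as the empty interior of \<open>L\<close>.\<close>

locale lifted_circle_action =
  fixes \<Gamma> :: "(real \<Rightarrow> real) set" and w :: "real \<Rightarrow> real" and L :: "real set"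
  assumes comp: "F \<in> \<Gamma> \<Longrightarrow> H \<in> \<Gamma> \<Longrightarrow> (\<lambda>t. F (H t)) \<in> \<Gamma>"
    and inverse: "F \<in> \<Gamma> \<Longrightarrow> \<exists>H\<in>\<Gamma>. (\<forall>t. F (H t) = t) \<and> (\<forall>t. H (F t) = t)"
    and translation: "(\<lambda>t. t + 2 * pi * of_int k) \<in> \<Gamma>"
    and has_deriv: "F \<in> \<Gamma> \<Longrightarrow> (F has_real_derivative deriv F t) (at t)"
    and deriv_pos: "F \<in> \<Gamma> \<Longrightarrow> deriv F t > 0"
    and ln_deriv_lipschitz: "F \<in> \<Gamma> \<Longrightarrow> \<exists>K. \<forall>u v. \<bar>ln (deriv F u) - ln (deriv F v)\<bar> \<le> K * \<bar>u - v\<bar>"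
    and w_cont: "continuous_on UNIV w"
    and w_pos: "w t > 0"
    and w_periodic: "w (t + 2 * pi * of_int k) = w t"
    and L_closed: "closed L"
    and L_interior: "interior L = {}"
    and L_invariant: "F \<in> \<Gamma> \<Longrightarrow> F t \<in> L \<longleftrightarrow> t \<in> L"
begin

section \<open>Derivatives with respect to the metric\<close>

definition expansion :: "(real \<Rightarrow> real) \<Rightarrow> real \<Rightarrow> real" where
  "expansion F t = w (F t) / w t * deriv F t"

definition nonexp :: "real set" where
  "nonexp = {t. \<forall>F\<in>\<Gamma>. expansion F t \<le> 1}"

text \<open>The extrema of \<open>w\<close> over one period bound it everywhere. This allows
  changing between \<open>deriv\<close> and \<open>expansion\<close> at the cost of a factor
  \<open>A\<close>.\<close>

lemma w_ratio_bounded: "\<exists>A>0. \<forall>s t. w s \<le> A * w t"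
proof -
  have cont: "continuous_on {0..2 * pi} w" using w_cont continuous_on_subset by blast
  have "{0..2 * pi} \<noteq> {}" by simp
  obtain a where a: "\<forall>t\<in>{0..2 * pi}. w t \<le> w a"
    using continuous_attains_sup[OF compact_Icc \<open>{0..2 * pi} \<noteq> {}\<close> cont] by blast
  obtain b where b: "\<forall>t\<in>{0..2 * pi}. w b \<le> w t"
    using continuous_attains_inf[OF compact_Icc \<open>{0..2 * pi} \<noteq> {}\<close> cont] by blast
  have ab: "w t \<le> w a \<and> w b \<le> w t" for t
  proof -
    obtain k where "t + 2 * pi * of_int k \<in> {0..<2 * pi}" by (rule reduce_mod_2pi)
    then show ?thesis using a[rule_format, of "t + 2 * pi * of_int k"] b[rule_format, of "t + 2 * pi * of_int k"]
      by (simp add: w_periodic)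
  qed
  have "w s \<le> w a / w b * w t" for s t
  proof -
    have "w s \<le> w a" "w a * w b \<le> w a * w t" using ab w_pos[of a] by auto
    then have "w s * w b \<le> w a * w t" using w_pos[of b] by (meson mult_right_mono less_imp_le order_trans)
    then show ?thesis using w_pos[of b] by (simp add: field_simps)
  qed
  then show ?thesis using w_pos by (intro exI[of _ "w a / w b"]) auto
qed

lemma expansion_pos: "F \<in> \<Gamma> \<Longrightarrow> expansion F t > 0"
  by (simp add: expansion_def w_pos deriv_pos)

lemma deriv_comp: "F \<in> \<Gamma> \<Longrightarrow> H \<in> \<Gamma> \<Longrightarrow> deriv (\<lambda>t. F (H t)) t = deriv F (H t) * deriv H t"
  by (rule DERIV_imp_deriv, rule DERIV_chain2) (simp_all add: has_deriv)

lemma expansion_comp: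
  "F \<in> \<Gamma> \<Longrightarrow> H \<in> \<Gamma> \<Longrightarrow> expansion (\<lambda>t. F (H t)) t = expansion F (H t) * expansion H t"
  using w_pos[of "H t"] by (simp add: expansion_def deriv_comp)

lemma expansion_translation: "expansion (\<lambda>t. t + 2 * pi * of_int k) t = 1"
proof -
  have "deriv (\<lambda>t::real. t + 2 * pi * of_int k) t = 1"
    by (rule DERIV_imp_deriv) (auto intro!: derivative_eq_intros)
  then show ?thesis using w_pos[of t] by (simp add: expansion_def w_periodic)
qed

lemma id_in: "(\<lambda>t. t) \<in> \<Gamma>"
  using translation[of 0] by simp

lemma expansion_id: "expansion (\<lambda>t. t) t = 1"
  using expansion_translation[of 0 t] by simp

lemma expansion_inverse:
  assumes "F \<in> \<Gamma>" "H \<in> \<Gamma>" "\<And>t. F (H t) = t"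
  shows "expansion F (H t) * expansion H t = 1"
  using expansion_comp[OF assms(1,2), of t] assms(3) expansion_id by simp

lemma isCont_deriv:
  assumes "F \<in> \<Gamma>" shows "isCont (deriv F) t"
proof -
  obtain K where K: "\<And>u v. \<bar>ln (deriv F u) - ln (deriv F v)\<bar> \<le> K * \<bar>u - v\<bar>"
    using ln_deriv_lipschitz[OF assms] by blast
  have "isCont (\<lambda>u. ln (deriv F u)) t"
    unfolding isCont_def
  proof (rule Lim_transform_bound[THEN Lim_null[THEN iffD2]], rule always_eventually, rule allI)
    show "norm (ln (deriv F u) - ln (deriv F t)) \<le> norm (K * \<bar>u - t\<bar>)" for u
      using K[of u t] by simp
    show "(\<lambda>u. K * \<bar>u - t\<bar>) \<midarrow>t\<rightarrow> 0" by (auto intro!: tendsto_eq_intros)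
  qed
  then have "isCont (\<lambda>u. exp (ln (deriv F u))) t" by (rule continuous_exp)
  then show ?thesis using deriv_pos[OF assms] by simp
qed

lemma isCont_expansion:
  assumes "F \<in> \<Gamma>" shows "isCont (expansion F) t"
proof -
  have "isCont w s" for s using w_cont by (simp add: continuous_on_eq_continuous_at)
  moreover have "isCont F t" using has_deriv[OF assms] DERIV_isCont by blast
  ultimately show ?thesis unfolding expansion_def
    using w_pos[of t] isCont_deriv[OF assms, of t]
    by (intro continuous_intros isCont_o2[of t F w]) auto
qed

lemma strict_mono_in: "F \<in> \<Gamma> \<Longrightarrow> strict_mono F"
  by (rule strict_monoI, rule DERIV_pos_imp_increasing) (use has_deriv deriv_pos in blast)+

lemma funpow_in: "F \<in> \<Gamma> \<Longrightarrow> F ^^ n \<in> \<Gamma>"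
proof (induction n)
  case 0 show ?case using id_in by (simp add: id_def)
next
  case (Suc n)
  then show ?case using comp[of F "F ^^ n"] by (simp add: o_def)
qed

text \<open>\<open>h\<close> is an inverse branch of an element expanding at \<open>x\<close>. The one parameter \<open>e\<close> plays
  three roles (rate, inverse distortion constant, radius) so that the property is antimonotone in
  \<open>e\<close> and compactness makes it uniform.\<close>

definition expansion_step :: "real \<Rightarrow> real \<Rightarrow> bool" where
  "expansion_step e x \<longleftrightarrow> (\<exists>h\<in>\<Gamma>. \<exists>y. h y = x \<and> (1 + e) * expansion h y \<le> 1 \<and>
     (\<forall>p\<in>cball y e. \<forall>q\<in>cball y e. \<bar>ln (deriv h p) - ln (deriv h q)\<bar> \<le> \<bar>p - q\<bar> / e))"

lemma expansion_step_antimono: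
  assumes "expansion_step e x" "0 < d" "d \<le> e"
  shows "expansion_step d x"
proof -
  obtain h y where h: "h \<in> \<Gamma>" "h y = x" "(1 + e) * expansion h y \<le> 1"
    "\<And>p q. p \<in> cball y e \<Longrightarrow> q \<in> cball y e \<Longrightarrow> \<bar>ln (deriv h p) - ln (deriv h q)\<bar> \<le> \<bar>p - q\<bar> / e"
    using assms(1) unfolding expansion_step_def by blast
  have "(1 + d) * expansion h y \<le> (1 + e) * expansion h y"
    using expansion_pos[OF h(1), of y] assms by (intro mult_right_mono) auto
  moreover have "\<bar>ln (deriv h p) - ln (deriv h q)\<bar> \<le> \<bar>p - q\<bar> / d"
    if "p \<in> cball y d" "q \<in> cball y d" for p q
  proof -
    have "\<bar>ln (deriv h p) - ln (deriv h q)\<bar> \<le> \<bar>p - q\<bar> / e"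
      using h(4) that assms by (auto simp: dist_real_def)
    also have "\<dots> \<le> \<bar>p - q\<bar> / d" using assms by (intro divide_left_mono) auto
    finally show ?thesis .
  qed
  ultimately show ?thesis unfolding expansion_step_def
    using h(1,2) order_trans[OF _ h(3)] by (intro bexI[of _ h] exI[of _ y]) auto
qed

lemma expansion_step_translate:
  assumes "expansion_step e (x + 2 * pi * of_int k)"
  shows "expansion_step e x"
proof -
  obtain h y where h: "h \<in> \<Gamma>" "h y = x + 2 * pi * of_int k" "(1 + e) * expansion h y \<le> 1"
    "\<forall>p\<in>cball y e. \<forall>q\<in>cball y e. \<bar>ln (deriv h p) - ln (deriv h q)\<bar> \<le> \<bar>p - q\<bar> / e"
    using assms unfolding expansion_step_def by blast
  define T where "T t = t + 2 * pi * of_int (- k)" for t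
  have T: "T \<in> \<Gamma>" "\<And>t. expansion T t = 1" "\<And>t. deriv T t = 1"
    using translation[of "- k"] expansion_translation[of "- k"] unfolding T_def[abs_def]
    by (auto intro!: DERIV_imp_deriv derivative_eq_intros)
  have "(\<lambda>t. T (h t)) \<in> \<Gamma>" "T (h y) = x"
    using comp[OF T(1) h(1)] h(2) by (auto simp: T_def)
  moreover have "expansion (\<lambda>t. T (h t)) y = expansion h y" "deriv (\<lambda>t. T (h t)) = deriv h"
    using T h by (auto simp: expansion_comp deriv_comp)
  ultimately show ?thesis using h(3,4) unfolding expansion_step_def
    by (intro bexI[of _ "\<lambda>t. T (h t)"] exI[of _ y]) auto
qed

text \<open>The inverse of \<open>h\<close> has expansion factor at least \<open>1 + e\<close> at
  \<open>x\<close>.\<close>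

lemma expansion_step_imp_expandable:
  assumes "expansion_step e x" "e > 0"
  shows "x \<notin> nonexp"
proof -
  obtain h y where h: "h \<in> \<Gamma>" "h y = x" "(1 + e) * expansion h y \<le> 1"
    using assms unfolding expansion_step_def by blast
  obtain F where F: "F \<in> \<Gamma>" "\<And>t. F (h t) = t" using inverse[OF h(1)] by blast
  have "expansion F x * expansion h y = 1" using expansion_inverse[OF F(1) h(1) F(2)] h(2) by blast
  moreover have "expansion h y < 1"
  proof -
    have "expansion h y + e * expansion h y \<le> 1" using h(3) by (simp add: algebra_simps)
    then show ?thesis using expansion_pos[OF h(1), of y] assms(2)
      by (smt (verit) mult_pos_pos)
  qed
  ultimately have "expansion F x > 1"
    using expansion_pos[OF h(1), of y] expansion_pos[OF F(1), of x]
    by (smt (verit) mult_left_le_one_le mult_le_cancel_right1)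
  then show ?thesis using F(1) unfolding nonexp_def by force
qed

text \<open>By continuity one element \<open>F\<close> expanding at \<open>x\<close> expands at all
  nearby \<open>t\<close>; its inverse, based at \<open>F t\<close>, is the required branch.\<close>

lemma expansion_step_near_expandable:
  assumes "x \<notin> nonexp"
  shows "\<exists>e>0. \<forall>t\<in>ball x e. expansion_step e t"
proof -
  obtain F where F: "F \<in> \<Gamma>" "expansion F x > 1" using assms by (auto simp: nonexp_def not_le)
  obtain h where h: "h \<in> \<Gamma>" "\<And>t. F (h t) = t" "\<And>t. h (F t) = t" using inverse[OF F(1)] by blast
  obtain K where K: "\<And>u v. \<bar>ln (deriv h u) - ln (deriv h v)\<bar> \<le> K * \<bar>u - v\<bar>"
    using ln_deriv_lipschitz[OF h(1)] by blast
  have K0: "K \<ge> 0" using K[of 0 1] by simp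
  define c where "c = (expansion F x - 1) / 2"
  have c: "c > 0" "1 + c < expansion F x" using F(2) by (auto simp: c_def field_simps)
  have "\<forall>\<^sub>F t in nhds x. 1 + c < expansion F t"
    using isCont_expansion[OF F(1), of x] c(2) unfolding continuous_at tendsto_at_iff_tendsto_nhds
    by (rule order_tendstoD)
  then obtain d where d: "d > 0" "\<And>t. dist t x < d \<Longrightarrow> 1 + c < expansion F t"
    by (auto simp: eventually_nhds_metric)
  \<comment> \<open>\<open>c\<close> controls the rate, \<open>d\<close> the neighbourhood on which
    \<open>F\<close> expands, and \<open>1 / (K + 1)\<close> the distortion of
    \<open>h\<close>.\<close>
  define e where "e = Min {c, d, 1 / (K + 1)}"
  have e: "e > 0" "e \<le> c" "e \<le> d" "e \<le> 1 / (K + 1)" using c d K0 by (auto simp: e_def)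
  have "K \<le> 1 / e" using e(1,4) K0 by (simp add: field_simps)
  have "expansion_step e t" if "t \<in> ball x e" for t
    unfolding expansion_step_def
  proof (intro bexI[of _ h] exI[of _ "F t"] conjI ballI h)
    have "expansion h (F t) * expansion F t = 1" by (rule expansion_inverse) (use h F in auto)
    moreover have "1 + e \<le> expansion F t" using d(2)[of t] that e by (simp add: dist_commute)
    ultimately show "(1 + e) * expansion h (F t) \<le> 1"
      using expansion_pos[OF h(1), of "F t"] by (metis mult.commute mult_right_mono less_imp_le)
    fix p q
    have "K * \<bar>p - q\<bar> \<le> 1 / e * \<bar>p - q\<bar>" by (rule mult_right_mono) (auto simp: \<open>K \<le> 1 / e\<close>)
    then show "\<bar>ln (deriv h p) - ln (deriv h q)\<bar> \<le> \<bar>p - q\<bar> / e" using K[of p q] by simp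
  qed
  with e(1) show ?thesis by blast
qed

text \<open>\<open>F t - t\<close> is continuous without zeros on the connected set
  \<open>I\<close>, so its sign is constant there.\<close>

lemma fixed_point_free_sign:
  assumes "F \<in> \<Gamma>" "F x = x" "connected I" "\<And>t. t \<in> I \<Longrightarrow> F t \<noteq> t"
  obtains h where "h \<in> \<Gamma>" "h x = x" "\<And>t. t \<in> I \<Longrightarrow> h t < t"
  | h where "h \<in> \<Gamma>" "h x = x" "\<And>t. t \<in> I \<Longrightarrow> t < h t"
proof (cases "\<exists>t\<in>I. F t < t")
  case True
  show ?thesis
  proof (rule that(1)[OF assms(1,2)], rule ccontr)
    fix t assume t: "t \<in> I" "\<not> F t < t"
    obtain s where s: "s \<in> I" "F s < s" using True by blast
    have "continuous_on I (\<lambda>t. F t - t)"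
      using has_deriv[OF assms(1)] DERIV_isCont
      by (intro continuous_intros continuous_at_imp_continuous_on) blast
    then have "connected ((\<lambda>t. F t - t) ` I)" using assms(3) connected_continuous_image by blast
    then have "0 \<in> (\<lambda>t. F t - t) ` I"
      unfolding connected_iff_interval
      using s t by (meson diff_ge_0_iff_ge image_eqI less_iff_diff_less_0 linorder_not_le less_imp_le)
    then show False using assms(4) by force
  qed
next
  case False
  then show ?thesis using that(2)[OF assms(1,2)] assms(4) by (metis linorder_neqE)
qed

text \<open>The weights cost at most the factor \<open>A\<close>, so derivative
  \<open>1 / (2 * A)\<close> means expansion at most \<open>1 / 2\<close>; with
  \<open>d \<le> 1\<close> the product with \<open>1 + d\<close> stays at most 1.\<close>

lemma expansion_step_of_small_deriv:
  assumes A: "\<And>s t. w s \<le> A * w t" "A > 0"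
    and "h \<in> \<Gamma>" "h y = t" "deriv h y \<le> 1 / (2 * A)" "0 < d" "d \<le> e" "d \<le> 1"
    and dist: "\<forall>p\<in>cball y e. \<forall>q\<in>cball y e. \<bar>ln (deriv h p) - ln (deriv h q)\<bar> \<le> \<bar>p - q\<bar> / e"
  shows "expansion_step d t"
  unfolding expansion_step_def
proof (intro bexI[of _ h] exI[of _ y] conjI ballI assms)
  have "w (h y) / w y \<le> A" using A(1)[of "h y" y] w_pos[of y] by (simp add: field_simps)
  then have "expansion h y \<le> A * (1 / (2 * A))" unfolding expansion_def
    using assms(5) deriv_pos[OF \<open>h \<in> \<Gamma>\<close>, of y] A(2) by (intro mult_mono) auto
  then have "expansion h y \<le> 1 / 2" using A by simp
  then have "(1 + d) * expansion h y \<le> 2 * (1 / 2)"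
    using assms expansion_pos[OF \<open>h \<in> \<Gamma>\<close>, of y] by (intro mult_mono) auto
  then show "(1 + d) * expansion h y \<le> 1" by simp
  fix p q assume "p \<in> cball y d" "q \<in> cball y d"
  then have "\<bar>ln (deriv h p) - ln (deriv h q)\<bar> \<le> \<bar>p - q\<bar> / e"
    using dist \<open>d \<le> e\<close> by (auto simp: dist_real_def)
  also have "\<dots> \<le> \<bar>p - q\<bar> / d" using assms by (intro divide_left_mono) auto
  finally show "\<bar>ln (deriv h p) - ln (deriv h q)\<bar> \<le> \<bar>p - q\<bar> / d" .
qed

text \<open>Either \<open>F\<close> or its inverse moves points on the right down towards
  \<open>x\<close>; iterates of that element, supplied by \<open>parabolic_right\<close>, are the
  contracting branches.\<close>

lemma expansion_step_right_of_fixed: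
  assumes "F \<in> \<Gamma>" "F x = x" "\<epsilon> > 0" "\<And>t. x < t \<Longrightarrow> t < x + \<epsilon> \<Longrightarrow> F t \<noteq> t"
  shows "\<exists>e>0. \<forall>t\<in>{x<..<x + e}. expansion_step e t"
proof -
  obtain A where A: "A > 0" "\<And>s t. w s \<le> A * w t" using w_ratio_bounded by blast
  obtain h where h: "h \<in> \<Gamma>" "h x = x" "\<And>t. t \<in> {x<..<x + \<epsilon>} \<Longrightarrow> h t < t"
  proof (rule fixed_point_free_sign[of F x "{x<..<x + \<epsilon>}"])
    fix k assume k: "k \<in> \<Gamma>" "k x = x" "\<And>t. t \<in> {x<..<x + \<epsilon>} \<Longrightarrow> t < k t"
    obtain h where h: "h \<in> \<Gamma>" "\<And>t. k (h t) = t" "\<And>t. h (k t) = t" using inverse[OF k(1)] by blast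
    have "h t < t" if t: "t \<in> {x<..<x + \<epsilon>}" for t
      using strict_monoD[OF strict_mono_in[OF h(1)] k(3)[OF t]] h(3) by simp
    then show ?thesis using that[of h] h k by metis
  qed (use assms that in auto)
  obtain K where K: "\<And>u v. \<bar>ln (deriv h u) - ln (deriv h v)\<bar> \<le> K * \<bar>u - v\<bar>"
    using ln_deriv_lipschitz[OF h(1)] by blast
  obtain e where e: "e > 0" "\<And>t. t \<in> {x<..<x + e} \<Longrightarrow>
      \<exists>n y. (h ^^ n) y = t \<and> deriv (h ^^ n) y \<le> 1 / (2 * A) \<and>
           (\<forall>p\<in>cball y e. \<forall>q\<in>cball y e.
              \<bar>ln (deriv (h ^^ n) p) - ln (deriv (h ^^ n) q)\<bar> \<le> \<bar>p - q\<bar> / e)"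
    using parabolic_right[OF has_deriv[OF h(1)] deriv_pos[OF h(1)] K h(2) \<open>\<epsilon> > 0\<close>, of "1 / (2 * A)"]
      h(3) A(1) by auto
  have "expansion_step (min e 1) t" if t: "t \<in> {x<..<x + min e 1}" for t
  proof -
    obtain n y where "(h ^^ n) y = t" "deriv (h ^^ n) y \<le> 1 / (2 * A)"
           "\<forall>p\<in>cball y e. \<forall>q\<in>cball y e.
              \<bar>ln (deriv (h ^^ n) p) - ln (deriv (h ^^ n) q)\<bar> \<le> \<bar>p - q\<bar> / e"
      using e(2)[OF subsetD[OF _ t]] by fastforce
    then show ?thesis using e(1)
      by (intro expansion_step_of_small_deriv[OF A(2,1) funpow_in[OF h(1)], of n y t "min e 1" e]) auto
  qed
  then show ?thesis using e(1) by (intro exI[of _ "min e 1"]) auto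
qed

text \<open>Mirror image of the right-hand case: the element used must now move points up towards
  \<open>x\<close>.\<close>

lemma expansion_step_left_of_fixed:
  assumes "F \<in> \<Gamma>" "F x = x" "\<epsilon> > 0" "\<And>t. x - \<epsilon> < t \<Longrightarrow> t < x \<Longrightarrow> F t \<noteq> t"
  shows "\<exists>e>0. \<forall>t\<in>{x - e<..<x}. expansion_step e t"
proof -
  obtain A where A: "A > 0" "\<And>s t. w s \<le> A * w t" using w_ratio_bounded by blast
  obtain h where h: "h \<in> \<Gamma>" "h x = x" "\<And>t. t \<in> {x - \<epsilon><..<x} \<Longrightarrow> t < h t"
  proof (rule fixed_point_free_sign[of F x "{x - \<epsilon><..<x}"])
    fix k assume k: "k \<in> \<Gamma>" "k x = x" "\<And>t. t \<in> {x - \<epsilon><..<x} \<Longrightarrow> k t < t"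
    obtain h where h: "h \<in> \<Gamma>" "\<And>t. k (h t) = t" "\<And>t. h (k t) = t" using inverse[OF k(1)] by blast
    have "t < h t" if t: "t \<in> {x - \<epsilon><..<x}" for t
      using strict_monoD[OF strict_mono_in[OF h(1)] k(3)[OF t]] h(3) by simp
    then show ?thesis using that[of h] h k by metis
  qed (use assms that in auto)
  obtain K where K: "\<And>u v. \<bar>ln (deriv h u) - ln (deriv h v)\<bar> \<le> K * \<bar>u - v\<bar>"
    using ln_deriv_lipschitz[OF h(1)] by blast
  obtain e where e: "e > 0" "\<And>t. t \<in> {x - e<..<x} \<Longrightarrow>
      \<exists>n y. (h ^^ n) y = t \<and> deriv (h ^^ n) y \<le> 1 / (2 * A) \<and>
           (\<forall>p\<in>cball y e. \<forall>q\<in>cball y e.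
              \<bar>ln (deriv (h ^^ n) p) - ln (deriv (h ^^ n) q)\<bar> \<le> \<bar>p - q\<bar> / e)"
    using parabolic_left[OF has_deriv[OF h(1)] deriv_pos[OF h(1)] K h(2) \<open>\<epsilon> > 0\<close>, of "1 / (2 * A)"]
      h(3) A(1) by auto
  have "expansion_step (min e 1) t" if t: "t \<in> {x - min e 1<..<x}" for t
  proof -
    obtain n y where "(h ^^ n) y = t" "deriv (h ^^ n) y \<le> 1 / (2 * A)"
           "\<forall>p\<in>cball y e. \<forall>q\<in>cball y e.
              \<bar>ln (deriv (h ^^ n) p) - ln (deriv (h ^^ n) q)\<bar> \<le> \<bar>p - q\<bar> / e"
      using e(2)[OF subsetD[OF _ t]] by fastforce
    then show ?thesis using e(1)
      by (intro expansion_step_of_small_deriv[OF A(2,1) funpow_in[OF h(1)], of n y t "min e 1" e]) auto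
  qed
  then show ?thesis using e(1) by (intro exI[of _ "min e 1"]) auto
qed

end

section \<open>Uniform expansion under property \<open>(\<Lambda>\<star>)\<close>\<close>

locale lifted_star_action = lifted_circle_action +
  assumes star: "x \<in> L \<Longrightarrow> x \<in> nonexp \<Longrightarrow> \<exists>F\<in>\<Gamma>. \<exists>H\<in>\<Gamma>. F x = x \<and> H x = x \<and>
    (\<exists>\<epsilon>>0. (\<forall>s\<in>{0<..<\<epsilon>}. F (x + s) \<noteq> x + s) \<and> (\<forall>s\<in>{0<..<\<epsilon>}. H (x - s) \<noteq> x - s))"
begin

text \<open>Continuity settles an expandable \<open>x\<close>; at a non-expandable one the two
  one-sided parabolic estimates cover everything but \<open>x\<close>. One statement thus yields
  both finiteness of the exceptions and uniformity elsewhere.\<close>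

lemma expansion_step_nearby:
  assumes "x \<in> L"
  shows "\<exists>e>0. \<forall>t\<in>ball x e. (t = x \<and> x \<in> nonexp) \<or> expansion_step e t"
proof (cases "x \<in> nonexp")
  case False
  then show ?thesis using expansion_step_near_expandable by blast
next
  case True
  obtain F H \<epsilon> where FH: "F \<in> \<Gamma>" "H \<in> \<Gamma>" "F x = x" "H x = x" "\<epsilon> > 0"
    "\<And>s. s \<in> {0<..<\<epsilon>} \<Longrightarrow> F (x + s) \<noteq> x + s" "\<And>s. s \<in> {0<..<\<epsilon>} \<Longrightarrow> H (x - s) \<noteq> x - s"
    using star[OF assms True] by blast
  have "F t \<noteq> t" if "x < t" "t < x + \<epsilon>" for t using FH(6)[of "t - x"] that by simp
  then obtain a where a: "a > 0" "\<And>t. t \<in> {x<..<x + a} \<Longrightarrow> expansion_step a t"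
    using expansion_step_right_of_fixed[OF FH(1,3,5)] by blast
  have "H t \<noteq> t" if "x - \<epsilon> < t" "t < x" for t using FH(7)[of "x - t"] that by simp
  then obtain b where b: "b > 0" "\<And>t. t \<in> {x - b<..<x} \<Longrightarrow> expansion_step b t"
    using expansion_step_left_of_fixed[OF FH(2,4,5)] by blast
  have "t = x \<or> expansion_step (min a b) t" if t: "t \<in> ball x (min a b)" for t
  proof -
    consider "t = x" | "t \<in> {x<..<x + a}" | "t \<in> {x - b<..<x}"
      using t by (cases t x rule: linorder_cases) (auto simp: dist_real_def)
    then show ?thesis
      using a b expansion_step_antimono[of a t "min a b"] expansion_step_antimono[of b t "min a b"]
      by cases auto
  qed
  then show ?thesis using a(1) b(1) True by (intro exI[of _ "min a b"]) auto
qed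

lemma finite_nonexp: "finite (L \<inter> nonexp \<inter> {0..2 * pi})"
proof -
  define K where "K = L \<inter> {0..2 * pi}"
  have K: "compact K" unfolding K_def by (intro closed_Int_compact L_closed compact_Icc)
  obtain r where r: "\<And>x. x \<in> L \<Longrightarrow> r x > 0 \<and> (\<forall>t\<in>ball x (r x). t = x \<or> expansion_step (r x) t)"
    using expansion_step_nearby by metis
  have "K \<subseteq> (\<Union>x\<in>K. ball x (r x))" using r by (force simp: K_def)
  then obtain C where C: "C \<subseteq> K" "finite C" "K \<subseteq> (\<Union>x\<in>C. ball x (r x))"
    using compactE_image[OF K, of K "\<lambda>x. ball x (r x)"] by blast
  \<comment> \<open>Within the ball about \<open>c\<close> all points except possibly
    \<open>c\<close> are expandable, so a non-expandable \<open>t\<close> is one of the finitely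
    many centres.\<close>
  have "t \<in> C" if t: "t \<in> K" "t \<in> nonexp" for t
  proof -
    obtain c where c: "c \<in> C" "t \<in> ball c (r c)" using C t by blast
    then have "c \<in> L" using C by (auto simp: K_def)
    then show ?thesis using r[OF \<open>c \<in> L\<close>] c t(2) expansion_step_imp_expandable by metis
  qed
  then have "L \<inter> nonexp \<inter> {0..2 * pi} \<subseteq> C" by (auto simp: K_def)
  then show ?thesis using C finite_subset by blast
qed

lemma nonexp_translation: "x + 2 * pi * of_int k \<in> nonexp \<Longrightarrow> x \<in> nonexp"
proof -
  assume *: "x + 2 * pi * of_int k \<in> nonexp"
  have "expansion F x \<le> 1" if F: "F \<in> \<Gamma>" for F
  proof -
    define T where "T = (\<lambda>t::real. t + 2 * pi * of_int (- k))"
    have T: "T \<in> \<Gamma>" unfolding T_def by (rule translation)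
    have "expansion (\<lambda>t. F (T t)) (x + 2 * pi * of_int k) = expansion F x"
      using expansion_comp[OF F T] expansion_translation[of "- k"] by (simp add: T_def)
    then show ?thesis using * comp[OF F T] by (force simp: nonexp_def)
  qed
  then show ?thesis by (simp add: nonexp_def)
qed

text \<open>Admitting non-expandable points as an alternative makes the property hold on full
  neighbourhoods, so compactness of one period applies; deck translations then reach all of
  \<open>L\<close>.\<close>

lemma uniform_expansion_step: "\<exists>e>0. \<forall>x\<in>L. x \<in> nonexp \<or> expansion_step e x"
proof -
  define P where "P e x \<longleftrightarrow> x \<in> nonexp \<or> expansion_step e x" for e x
  have "compact (L \<inter> {0..2 * pi})" by (intro closed_Int_compact L_closed compact_Icc)
  moreover have "P d x" if "P e x" "0 < d" "d \<le> e" for d e x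
    using that(1) expansion_step_antimono[OF _ that(2,3)] by (auto simp: P_def)
  moreover have "\<exists>e>0. \<forall>t\<in>ball x e. P e t" if x: "x \<in> L \<inter> {0..2 * pi}" for x
  proof -
    obtain e where "e > 0" "\<forall>t\<in>ball x e. (t = x \<and> x \<in> nonexp) \<or> expansion_step e t"
      using expansion_step_nearby[of x] x by blast
    then show ?thesis by (intro exI[of _ e]) (auto simp: P_def)
  qed
  ultimately have "\<exists>e>0. \<forall>x\<in>L \<inter> {0..2 * pi}. P e x" by (rule compact_uniform_radius)
  then obtain e where e: "e > 0" "\<And>x. x \<in> L \<inter> {0..2 * pi} \<Longrightarrow> x \<in> nonexp \<or> expansion_step e x"
    unfolding P_def by blast
  have "x \<in> nonexp \<or> expansion_step e x" if "x \<in> L" for x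
  proof -
    obtain k where k: "x + 2 * pi * of_int k \<in> {0..<2 * pi}" by (rule reduce_mod_2pi)
    moreover have "x + 2 * pi * of_int k \<in> L" using L_invariant[OF translation] that by blast
    ultimately show ?thesis
      using e(2)[of "x + 2 * pi * of_int k"] nonexp_translation expansion_step_translate by fastforce
  qed
  with e(1) show ?thesis by blast
qed

text \<open>As \<open>\<Gamma>\<close> is a group, this is the \<open>\<Gamma>\<close>-orbit of
  \<open>nonexp\<close>.\<close>

definition exceptional_points :: "real set" where
  "exceptional_points = {x. \<exists>F\<in>\<Gamma>. F x \<in> nonexp}"

text \<open>The radius \<open>\<rho>\<close> is chosen so small that the distortions of the successive steps are dominated
  by a geometric series of sum at most \<open>1\<close>; bounded distortion of the later steps is what
  makes the pulled back balls shrink geometrically.\<close>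

lemma iterated_expansion:
  obtains e \<rho> where "e > 0" "\<rho> > 0" "\<And>n x. x \<in> L - exceptional_points \<Longrightarrow>
    \<exists>H\<in>\<Gamma>. \<exists>y. H y = x \<and> (1 + e) ^ n * expansion H y \<le> 1 \<and>
     (\<forall>p\<in>cball y \<rho>. \<forall>q\<in>cball y \<rho>. ln (deriv H p) - ln (deriv H q) \<le> 1)"
proof -
  obtain e where e: "e > 0" "\<And>x. x \<in> L \<Longrightarrow> x \<in> nonexp \<or> expansion_step e x"
    using uniform_expansion_step by blast
  obtain A where A: "A > 0" "\<And>s t. w s \<le> A * w t" using w_ratio_bounded by blast
  \<comment> \<open>\<open>\<kappa>\<close> makes the series \<open>\<kappa> / (1 + e) ^ j\<close>
    have sum 1. \<open>\<rho>\<close> is chosen so that a set of diameter \<open>2 * \<rho>\<close>,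
    contracted at rate \<open>exp 1 * A / (1 + e) ^ n\<close>, has diameter at most
    \<open>e * \<kappa> / (1 + e) ^ n\<close>; the next step then adds distortion at most
    \<open>\<kappa> / (1 + e) ^ n\<close>.\<close>
  define \<kappa> where "\<kappa> = e / (1 + e)"
  define \<rho> where "\<rho> = e * \<kappa> / (2 * exp 1 * A)"
  have \<kappa>: "0 < \<kappa>" "\<kappa> \<le> 1" using e(1) by (auto simp: \<kappa>_def)
  have \<rho>: "0 < \<rho>" "2 * (exp 1 * A * \<rho>) = e * \<kappa>" using e(1) \<kappa> A(1) by (auto simp: \<rho>_def)
  have geo: "(\<Sum>j<n. \<kappa> / (1 + e) ^ j) \<le> 1" for n
  proof -
    have "(\<Sum>j<n. \<kappa> / (1 + e) ^ j) = 1 - 1 / (1 + e) ^ n"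
    proof (induction n)
      case (Suc n)
      have "1 - 1 / (1 + e) ^ n + \<kappa> / (1 + e) ^ n = 1 - (1 - \<kappa>) / (1 + e) ^ n"
        by (simp add: diff_divide_distrib)
      also have "1 - \<kappa> = 1 / (1 + e)" using e(1) by (simp add: \<kappa>_def field_simps)
      finally show ?case using Suc by simp
    qed simp
    then show ?thesis using e(1) by simp
  qed
  have main: "\<exists>H\<in>\<Gamma>. \<exists>y. H y = x \<and> (1 + e) ^ n * expansion H y \<le> 1 \<and>
     (\<forall>p\<in>cball y \<rho>. \<forall>q\<in>cball y \<rho>. \<bar>ln (deriv H p) - ln (deriv H q)\<bar> \<le> (\<Sum>j<n. \<kappa> / (1 + e) ^ j))"
    if "x \<in> L - exceptional_points" for n x
    using that
  proof (induction n arbitrary: x)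
    case 0
    have "deriv (\<lambda>t. t) = (\<lambda>t::real. 1)" by (auto intro!: DERIV_imp_deriv)
    then show ?case using id_in expansion_id by (intro bexI[of _ "\<lambda>t. t"] exI[of _ x]) auto
  next
    case (Suc n)
    have "x \<notin> nonexp" using Suc.prems id_in by (auto simp: exceptional_points_def)
    then obtain h z where h: "h \<in> \<Gamma>" "h z = x" "(1 + e) * expansion h z \<le> 1"
      "\<And>p q. p \<in> cball z e \<Longrightarrow> q \<in> cball z e \<Longrightarrow> \<bar>ln (deriv h p) - ln (deriv h q)\<bar> \<le> \<bar>p - q\<bar> / e"
      using e(2)[of x] Suc.prems unfolding expansion_step_def by blast
    have "z \<in> L" using L_invariant[OF h(1), of z] h(2) Suc.prems by simp
    \<comment> \<open>The complement of an orbit is invariant, so the induction hypothesis is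
      available at \<open>z\<close>.\<close>
    moreover have "z \<notin> exceptional_points"
    proof
      assume "z \<in> exceptional_points"
      then obtain F where F: "F \<in> \<Gamma>" "F z \<in> nonexp" by (auto simp: exceptional_points_def)
      obtain g where g: "g \<in> \<Gamma>" "\<And>t. g (h t) = t" using inverse[OF h(1)] by blast
      have "F (g x) = F z" using g(2)[of z] h(2) by simp
      then show False using comp[OF F(1) g(1)] F(2) Suc.prems by (auto simp: exceptional_points_def)
    qed
    \<comment> \<open>The new step \<open>h\<close> is composed on the outside: \<open>H\<close> has
      already shrunk the ball about \<open>y\<close> when \<open>h\<close> acts on it.\<close>
    ultimately obtain H y where H: "H \<in> \<Gamma>" "H y = z" "(1 + e) ^ n * expansion H y \<le> 1"
      "\<And>p q. p \<in> cball y \<rho> \<Longrightarrow> q \<in> cball y \<rho> \<Longrightarrow>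
          \<bar>ln (deriv H p) - ln (deriv H q)\<bar> \<le> (\<Sum>j<n. \<kappa> / (1 + e) ^ j)"
      using Suc.IH[of z] by blast
    have E1: "expansion H y \<le> 1 / (1 + e) ^ n" using H(3) e(1) by (simp add: field_simps)
    have E2: "(1 + e) ^ Suc n * expansion (\<lambda>t. h (H t)) y \<le> 1"
    proof -
      have "((1 + e) ^ n * expansion H y) * ((1 + e) * expansion h z) \<le> 1 * 1"
        using H(3) h(3) expansion_pos[OF h(1), of z] e(1) by (intro mult_mono) auto
      then show ?thesis using expansion_comp[OF h(1) H(1), of y] H(2) by (simp add: mult_ac)
    qed
    \<comment> \<open>Distortion at most 1 gives the factor \<open>exp 1\<close> relative to the
      derivative at \<open>y\<close>, and the weights give \<open>A\<close>.\<close>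
    have dH: "deriv H \<xi> \<le> exp 1 * (A / (1 + e) ^ n)" if "\<xi> \<in> cball y \<rho>" for \<xi>
    proof -
      have "ln (deriv H \<xi>) - ln (deriv H y) \<le> 1"
        using H(4)[OF that, of y] geo[of n] \<rho>(1) by simp
      then have "deriv H \<xi> \<le> exp 1 * deriv H y"
        using deriv_pos[OF H(1)] by (intro le_exp_mult_of_ln_diff_le) auto
      moreover have "deriv H y \<le> A * expansion H y"
        using A(2)[of y "H y"] w_pos[of y] deriv_pos[OF H(1), of y]
        by (simp add: expansion_def field_simps)
      moreover have "A * expansion H y \<le> A / (1 + e) ^ n"
        using mult_left_mono[OF E1, of A] A(1) by simp
      ultimately show ?thesis by (smt (verit) mult_left_mono exp_ge_zero)
    qed
    have HLip: "\<bar>H p - H q\<bar> \<le> exp 1 * (A / (1 + e) ^ n) * \<bar>p - q\<bar>"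
      if "p \<in> cball y \<rho>" "q \<in> cball y \<rho>" for p q
    proof -
      obtain \<xi> where \<xi>: "\<xi> \<in> closed_segment q p" "H p - H q = deriv H \<xi> * (p - q)"
        by (rule mean_value_closed_segment[OF has_deriv[OF H(1)], of q p])
      have "\<xi> \<in> cball y \<rho>" using \<xi>(1) closed_segment_subset[OF that(2,1) convex_cball] by blast
      then show ?thesis using dH[of \<xi>] deriv_pos[OF H(1), of \<xi>] unfolding \<xi>(2) abs_mult
        by (intro mult_right_mono) auto
    qed
    have small: "exp 1 * (A / (1 + e) ^ n) * (2 * \<rho>) = e * (\<kappa> / (1 + e) ^ n)"
      using \<rho>(2) by (simp add: mult_ac)
    have Hball: "H p \<in> cball z e" if "p \<in> cball y \<rho>" for p
    proof -
      have "\<bar>H p - H y\<bar> \<le> exp 1 * (A / (1 + e) ^ n) * \<bar>p - y\<bar>" using HLip[OF that, of y] \<rho>(1) by simp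
      also have "\<dots> \<le> exp 1 * (A / (1 + e) ^ n) * (2 * \<rho>)"
        using that A(1) e(1) \<rho>(1) by (intro mult_left_mono) (auto simp: dist_real_def)
      also have "\<dots> \<le> e * (1 / 1)"
        unfolding small using \<kappa> e(1) by (intro mult_left_mono frac_le) simp_all
      finally show ?thesis by (simp add: H(2) dist_real_def abs_minus_commute)
    qed
    have "\<bar>ln (deriv (\<lambda>t. h (H t)) p) - ln (deriv (\<lambda>t. h (H t)) q)\<bar> \<le> (\<Sum>j<Suc n. \<kappa> / (1 + e) ^ j)"
      if p: "p \<in> cball y \<rho>" and q: "q \<in> cball y \<rho>" for p q
    proof -
      have "\<bar>ln (deriv h (H p)) - ln (deriv h (H q))\<bar> \<le> \<bar>H p - H q\<bar> / e"
        by (intro h(4) Hball p q)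
      also have "\<dots> \<le> exp 1 * (A / (1 + e) ^ n) * (2 * \<rho>) / e"
      proof (rule divide_right_mono[OF order_trans[OF HLip[OF p q]]])
        have "\<bar>p - q\<bar> \<le> 2 * \<rho>" using p q by (auto simp: dist_real_def)
        then show "exp 1 * (A / (1 + e) ^ n) * \<bar>p - q\<bar> \<le> exp 1 * (A / (1 + e) ^ n) * (2 * \<rho>)"
          using A(1) e(1) by (intro mult_left_mono) auto
      qed (use e(1) in simp)
      also have "\<dots> = \<kappa> / (1 + e) ^ n" unfolding small using e(1) by simp
      finally show ?thesis
        using H(4)[OF p q] deriv_pos[OF h(1)] deriv_pos[OF H(1)]
        by (simp add: deriv_comp[OF h(1) H(1)] ln_mult_pos)
    qed
    moreover have "h (H y) = x" using H(2) h(2) by simp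
    ultimately show ?case using E2 comp[OF h(1) H(1)]
      by (intro bexI[of _ "\<lambda>t. h (H t)"] exI[of _ y]) blast+
  qed
  show thesis
  proof (rule that[OF e(1) \<rho>(1)])
    fix n x assume "x \<in> L - exceptional_points"
    from main[OF this, of n] obtain H y where H: "H \<in> \<Gamma>" "H y = x" "(1 + e) ^ n * expansion H y \<le> 1"
      "\<And>p q. p \<in> cball y \<rho> \<Longrightarrow> q \<in> cball y \<rho> \<Longrightarrow>
          \<bar>ln (deriv H p) - ln (deriv H q)\<bar> \<le> (\<Sum>j<n. \<kappa> / (1 + e) ^ j)" by blast
    have "ln (deriv H p) - ln (deriv H q) \<le> 1" if "p \<in> cball y \<rho>" "q \<in> cball y \<rho>" for p q
      using H(4)[OF that] geo[of n] by simp
    then show "\<exists>H\<in>\<Gamma>. \<exists>y. H y = x \<and> (1 + e) ^ n * expansion H y \<le> 1 \<and>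
       (\<forall>p\<in>cball y \<rho>. \<forall>q\<in>cball y \<rho>. ln (deriv H p) - ln (deriv H q) \<le> 1)"
      using H by blast
  qed
qed

text \<open>The inverse of the \<open>n\<close>-fold branch has factor at least
  \<open>(1 + e) ^ n\<close> at \<open>x\<close>.\<close>

lemma expansion_unbounded:
  assumes "x \<in> L - exceptional_points"
  shows "\<exists>F\<in>\<Gamma>. M < expansion F x"
proof -
  obtain e \<rho> where e: "e > 0" "\<And>n x. x \<in> L - exceptional_points \<Longrightarrow>
    \<exists>H\<in>\<Gamma>. \<exists>y. H y = x \<and> (1 + e) ^ n * expansion H y \<le> 1"
    using iterated_expansion by metis
  obtain n where n: "M < (1 + e) ^ n" using real_arch_pow[of "1 + e" M] e(1) by auto
  obtain H y where H: "H \<in> \<Gamma>" "H y = x" "(1 + e) ^ n * expansion H y \<le> 1"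
    using e(2)[OF assms, of n] by blast
  obtain F where F: "F \<in> \<Gamma>" "\<And>t. F (H t) = t" using inverse[OF H(1)] by blast
  have "expansion F x * expansion H y = 1" using expansion_inverse[OF F(1) H(1) F(2), of y] H(2) by simp
  then have "(1 + e) ^ n * expansion H y \<le> expansion F x * expansion H y" using H(3) by simp
  then have "(1 + e) ^ n \<le> expansion F x" using expansion_pos[OF H(1), of y] by simp
  then have "M < expansion F x" using n by simp
  then show ?thesis using F(1) by blast
qed

text \<open>\<open>L\<close> is closed with empty interior, so every ball contains a hole;
  compactness of one period and invariance under translations make its size independent of the
  centre.\<close>

lemma uniform_gap:
  assumes "r > 0"
  shows "\<exists>\<sigma>>0. \<forall>y. \<exists>z. ball z \<sigma> \<subseteq> ball y r - L"
proof -
  have "\<exists>\<sigma>>0. \<forall>y\<in>{0..2 * pi}. \<exists>z. ball z \<sigma> \<subseteq> ball y r - L"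
  proof (rule compact_uniform_radius[where P = "\<lambda>\<sigma> y. \<exists>z. ball z \<sigma> \<subseteq> ball y r - L"])
    show "\<exists>z. ball z d \<subseteq> ball y r - L" if "\<exists>z. ball z e \<subseteq> ball y r - L" "d \<le> e" for d e y
      using that by (meson order_trans subset_ball)
    show "\<exists>e>0. \<forall>t\<in>ball y e. \<exists>z. ball z e \<subseteq> ball t r - L" for y
    proof -
      \<comment> \<open>The hole is sought in the half ball so that it still lies in
        \<open>ball t r\<close> when the centre moves from \<open>y\<close> to a nearby
        \<open>t\<close>.\<close>
      have "\<not> ball y (r / 2) \<subseteq> L"
        using interior_maximal[of "ball y (r / 2)" L] L_interior assms by force
      then obtain z where z: "z \<in> ball y (r / 2) - L" by blast
      have "open (ball y (r / 2) - L)" using L_closed by (intro open_Diff) auto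
      then obtain d where d: "d > 0" "ball z d \<subseteq> ball y (r / 2) - L"
        using z open_contains_ball by meson
      have "ball y (r / 2) \<subseteq> ball t r" if "t \<in> ball y (min d (r / 2))" for t
      proof
        fix u assume "u \<in> ball y (r / 2)"
        then have "\<bar>y - u\<bar> < r / 2" "\<bar>y - t\<bar> < r / 2" using that by (auto simp: dist_real_def)
        then show "u \<in> ball t r" unfolding mem_ball dist_real_def by linarith
      qed
      moreover have "ball z (min d (r / 2)) \<subseteq> ball z d" by (rule subset_ball) simp
      ultimately have "\<forall>t\<in>ball y (min d (r / 2)). ball z (min d (r / 2)) \<subseteq> ball t r - L"
        using d(2) by blast
      then show ?thesis using d(1) assms by (intro exI[of _ "min d (r / 2)"]) auto
    qed
  qed auto
  then obtain \<sigma> where \<sigma>: "\<sigma> > 0" "\<And>y. y \<in> {0..2 * pi} \<Longrightarrow> \<exists>z. ball z \<sigma> \<subseteq> ball y r - L" by blast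
  have "\<exists>z. ball z \<sigma> \<subseteq> ball y r - L" for y
  proof -
    obtain k where k: "y + 2 * pi * of_int k \<in> {0..<2 * pi}" by (rule reduce_mod_2pi)
    then obtain z where z: "ball z \<sigma> \<subseteq> ball (y + 2 * pi * of_int k) r - L" using \<sigma>(2) by fastforce
    have "ball (z - 2 * pi * of_int k) \<sigma> \<subseteq> ball y r - L"
    proof
      fix t assume t: "t \<in> ball (z - 2 * pi * of_int k) \<sigma>"
      then have "t + 2 * pi * of_int k \<in> ball z \<sigma>" by (simp add: dist_real_def algebra_simps)
      then have "t + 2 * pi * of_int k \<in> ball (y + 2 * pi * of_int k) r - L" using z by blast
      then show "t \<in> ball y r - L" using L_invariant[OF translation] by (auto simp: dist_real_def)
    qed
    then show ?thesis by blast
  qed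
  with \<sigma>(1) show ?thesis by blast
qed

text \<open>The branch \<open>H\<close> carries a gap near \<open>y\<close> to a gap near
  \<open>x\<close>; bounded distortion preserves the ratio of hole to ball up to a constant, at
  arbitrarily small scales.\<close>

lemma porous:
  obtains c where "c > 0" "\<And>x r. x \<in> L - exceptional_points \<Longrightarrow> r > 0 \<Longrightarrow>
      \<exists>d z. 0 < d \<and> d < r \<and> ball z (c * d) \<subseteq> ball x d - L"
proof -
  obtain e \<rho> where e: "e > 0" "\<rho> > 0" and iter: "\<And>n x. x \<in> L - exceptional_points \<Longrightarrow>
    \<exists>H\<in>\<Gamma>. \<exists>y. H y = x \<and> (1 + e) ^ n * expansion H y \<le> 1 \<and>
     (\<forall>p\<in>cball y \<rho>. \<forall>q\<in>cball y \<rho>. ln (deriv H p) - ln (deriv H q) \<le> 1)"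
    using iterated_expansion by blast
  obtain A where A: "A > 0" "\<And>s t. w s \<le> A * w t" using w_ratio_bounded by blast
  obtain \<sigma> where \<sigma>: "\<sigma> > 0" "\<And>y. \<exists>z. ball z \<sigma> \<subseteq> ball y \<rho> - L" using uniform_gap[OF e(2)] by blast
  \<comment> \<open>One \<open>exp 1\<close> comes from the upper bound on \<open>deriv H\<close>,
    which sets the radius \<open>d = exp 1 * s * \<rho>\<close>, the other from the lower bound,
    which gives a hole of radius \<open>s * \<sigma> / exp 1 = c * d\<close>.\<close>
  define c where "c = \<sigma> / (exp 1 * exp 1 * \<rho>)"
  show thesis
  proof (rule that)
    show "c > 0" using \<sigma>(1) e(2) by (simp add: c_def)
    fix x r :: real assume x: "x \<in> L - exceptional_points" and "r > 0"
    \<comment> \<open>Since \<open>s \<le> A / (1 + e) ^ n\<close>, this makes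
      \<open>d < r\<close>.\<close>
    obtain n where n: "exp 1 * A * \<rho> / r < (1 + e) ^ n"
      using real_arch_pow[of "1 + e"] e(1) by auto
    obtain H y where H: "H \<in> \<Gamma>" "H y = x" "(1 + e) ^ n * expansion H y \<le> 1"
      and dist: "\<And>p q. p \<in> cball y \<rho> \<Longrightarrow> q \<in> cball y \<rho> \<Longrightarrow> ln (deriv H p) - ln (deriv H q) \<le> 1"
      using iter[OF x, of n] by blast
    define s where "s = deriv H y"
    define d where "d = exp 1 * s * \<rho>"
    have s: "s > 0" unfolding s_def by (rule deriv_pos[OF H(1)])
    have y: "y \<in> cball y \<rho>" using e(2) by simp
    have up: "deriv H p \<le> exp 1 * s" if "p \<in> cball y \<rho>" for p
      unfolding s_def by (intro le_exp_mult_of_ln_diff_le deriv_pos[OF H(1)] dist that y)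
    have low: "s \<le> exp 1 * deriv H p" if "p \<in> cball y \<rho>" for p
      unfolding s_def by (intro le_exp_mult_of_ln_diff_le deriv_pos[OF H(1)] dist that y)
    have "d > 0" using s e by (simp add: d_def)
    moreover have "d < r"
    proof -
      have "s \<le> A * expansion H y"
        using A(2)[of y "H y"] w_pos[of y] s by (simp add: expansion_def s_def field_simps)
      then have "(1 + e) ^ n * s \<le> A * ((1 + e) ^ n * expansion H y)"
        using e(1) by (metis mult.left_commute mult_left_mono zero_le_power add_nonneg_nonneg zero_le_one less_imp_le)
      also have "\<dots> \<le> A * 1" using H(3) A(1) by (intro mult_left_mono) auto
      finally have "(1 + e) ^ n * s \<le> A" by simp
      then have "(exp 1 * \<rho>) * ((1 + e) ^ n * s) \<le> (exp 1 * \<rho>) * A" using e(2) by (intro mult_left_mono) auto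
      also have "\<dots> < (1 + e) ^ n * r" using n \<open>r > 0\<close> by (simp add: field_simps)
      finally have "(1 + e) ^ n * d < (1 + e) ^ n * r" by (simp add: d_def mult_ac)
      then show ?thesis using e(1) by (simp add: mult_less_cancel_left_pos)
    qed
    moreover obtain z where z: "ball z \<sigma> \<subseteq> ball y \<rho> - L" using \<sigma>(2) by blast
    obtain g where g: "g \<in> \<Gamma>" "\<And>t. H (g t) = t" "\<And>t. g (H t) = t" using inverse[OF H(1)] by blast
    \<comment> \<open>The end points \<open>z - \<sigma>\<close> and \<open>z + \<sigma>\<close> may
      lie on the boundary; distortion is known on closed balls for this reason.\<close>
    have zy: "z \<in> cball y \<rho>" "z - \<sigma> \<in> cball y \<rho>" "z + \<sigma> \<in> cball y \<rho>"
    proof -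
      have "ball z \<sigma> \<subseteq> cball y \<rho>" using z by auto
      then have "cball z \<sigma> \<subseteq> cball y \<rho>" using \<sigma>(1) by (simp add: ball_subset_cball_iff cball_subset_cball_iff)
      then show "z \<in> cball y \<rho>" "z - \<sigma> \<in> cball y \<rho>" "z + \<sigma> \<in> cball y \<rho>"
        using \<sigma>(1) by (auto simp: subset_iff dist_real_def)
    qed
    have "ball (H z) (c * d) \<subseteq> ball x d - L"
    proof
      fix t assume "t \<in> ball (H z) (c * d)"
      then have t: "\<bar>H z - t\<bar> < s * \<sigma> / exp 1"
        using e(2) by (simp add: dist_real_def c_def d_def mult.commute)
      \<comment> \<open>\<open>H\<close> increases by at least the hole radius on either side of
        \<open>z\<close>, so by monotonicity the hole about \<open>H z\<close> has its preimage in
        \<open>ball z \<sigma>\<close>.\<close>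
      have step: "s * \<sigma> / exp 1 \<le> H q - H p"
        if pq: "p \<in> cball y \<rho>" "q \<in> cball y \<rho>" "q - p = \<sigma>" for p q
      proof -
        obtain \<xi> where \<xi>: "\<xi> \<in> closed_segment p q" "H q - H p = deriv H \<xi> * (q - p)"
          by (rule mean_value_closed_segment[OF has_deriv[OF H(1)], of p q])
        have "\<xi> \<in> cball y \<rho>" using \<xi>(1) closed_segment_subset[OF pq(1,2) convex_cball] by blast
        then have "s / exp 1 * \<sigma> \<le> deriv H \<xi> * \<sigma>"
          using low[of \<xi>] \<sigma>(1) by (intro mult_right_mono) (auto simp: field_simps)
        then show ?thesis using \<xi>(2) pq(3) by simp
      qed
      have "H (z - \<sigma>) < t" "t < H (z + \<sigma>)"
        using t step[OF zy(2,1)] step[OF zy(1,3)] by auto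
      then have "z - \<sigma> < g t" "g t < z + \<sigma>"
        using strict_monoD[OF strict_mono_in[OF g(1)]] g(3) by metis+
      then have "g t \<in> ball z \<sigma>" by (simp add: dist_real_def)
      then have gt: "g t \<in> ball y \<rho>" "g t \<notin> L" using z by auto
      obtain \<xi> where \<xi>: "\<xi> \<in> closed_segment y (g t)" "H (g t) - H y = deriv H \<xi> * (g t - y)"
        by (rule mean_value_closed_segment[OF has_deriv[OF H(1)], of y "g t"])
      have "\<xi> \<in> cball y \<rho>"
        using \<xi>(1) closed_segment_subset[OF y _ convex_cball, of "g t"] gt(1) by auto
      then have "\<bar>t - x\<bar> \<le> exp 1 * s * \<bar>g t - y\<bar>"
        using \<xi>(2) up[of \<xi>] deriv_pos[OF H(1), of \<xi>] g(2)[of t] H(2)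
        by (simp add: abs_mult mult_right_mono)
      also have "\<dots> < d" unfolding d_def using gt(1) s by (intro mult_strict_left_mono) (auto simp: dist_real_def)
      finally have "t \<in> ball x d" by (simp add: dist_real_def)
      moreover have "t \<notin> L" using gt(2) L_invariant[OF g(1)] by blast
      ultimately show "t \<in> ball x d - L" by blast
    qed
    ultimately show "\<exists>d z. 0 < d \<and> d < r \<and> ball z (c * d) \<subseteq> ball x d - L" by blast
  qed
qed

lemma negligible_L:
  assumes "countable (exceptional_points \<inter> L \<inter> {0..<2 * pi})"
  shows "negligible (L \<inter> {0..<2 * pi})"
proof -
  define Q where "Q = exceptional_points \<inter> L \<inter> {0..<2 * pi}"
  obtain c where c: "c > 0" "\<And>x r. x \<in> L - exceptional_points \<Longrightarrow> r > 0 \<Longrightarrow>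
      \<exists>d z. 0 < d \<and> d < r \<and> ball z (c * d) \<subseteq> ball x d - L"
    using porous by blast
  have neg: "negligible Q" unfolding Q_def negligible_iff_null_sets
    using countable_imp_null_set_lborel[OF assms] by (rule null_sets_completionI)
  have "L \<inter> {0..<2 * pi} \<in> sets lebesgue" using L_closed by (intro sets.Int) auto
  moreover have "bounded (L \<inter> {0..<2 * pi})" by (rule bounded_subset[OF bounded_closed_interval[of 0 "2 * pi"]]) auto
  ultimately have "L \<inter> {0..<2 * pi} \<in> lmeasurable" by (rule bounded_set_imp_lmeasurable[rotated])
  then have meas: "L \<inter> {0..<2 * pi} - Q \<in> lmeasurable"
    using neg by (meson fmeasurable.Diff negligible_imp_measurable)
  have "negligible (L \<inter> {0..<2 * pi} - Q)"
  proof (rule porous_negligible[OF meas c(1)])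
    fix x r :: real assume "x \<in> L \<inter> {0..<2 * pi} - Q" "r > 0"
    then obtain d z where "0 < d" "d < r" "ball z (c * d) \<subseteq> ball x d - L"
      using c(2)[of x r] by (auto simp: Q_def)
    then show "\<exists>d z. 0 < d \<and> d < r \<and> ball z (c * d) \<subseteq> ball x d - (L \<inter> {0..<2 * pi} - Q)" by blast
  qed
  then have "negligible ((L \<inter> {0..<2 * pi} - Q) \<union> Q)" using neg by (rule negligible_Un)
  then show ?thesis by (rule negligible_subset) auto
qed

end

section \<open>Lifts of circle diffeomorphisms\<close>

lemma cis_eq_iff: "cis s = cis t \<longleftrightarrow> (\<exists>k::int. s = t + 2 * pi * of_int k)"
  using sin_cos_eq_iff[of s t] by (auto simp: complex_eq_iff)

lemma cis_add_2pi: "cis (t + 2 * pi * of_int k) = cis t"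
  unfolding cis_eq_iff by blast

text \<open>The difference is continuous with values in the discrete set of multiples of
  \<open>2 * pi\<close>.\<close>

lemma cis_equal_lifts_differ_by_constant:
  fixes F H :: "real \<Rightarrow> real"
  assumes "continuous_on UNIV F" "continuous_on UNIV H" "\<And>t. cis (F t) = cis (H t)"
  obtains k :: int where "\<And>t. F t = H t + 2 * pi * of_int k"
proof -
  have *: "\<exists>k::int. F t - H t = 2 * pi * of_int k" for t
    using assms(3)[of t] unfolding cis_eq_iff by auto
  have "(\<lambda>t. F t - H t) constant_on UNIV"
  proof (rule continuous_discrete_range_constant)
    show "\<exists>e>0. \<forall>y. y \<in> UNIV \<and> F y - H y \<noteq> F x - H x \<longrightarrow> e \<le> norm ((F y - H y) - (F x - H x))" for x
    proof (intro exI[of _ "2 * pi"] conjI allI impI)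
      fix y assume y: "y \<in> UNIV \<and> F y - H y \<noteq> F x - H x"
      obtain j k :: int where jk: "F y - H y = 2 * pi * of_int j" "F x - H x = 2 * pi * of_int k"
        using * by blast
      then have "1 \<le> \<bar>j - k\<bar>" using y by auto
      then have "1 \<le> real_of_int \<bar>j - k\<bar>" by linarith
      then have "2 * pi * 1 \<le> 2 * pi * real_of_int \<bar>j - k\<bar>" by (intro mult_left_mono) auto
      also have "\<dots> = norm ((F y - H y) - (F x - H x))"
        unfolding jk right_diff_distrib[symmetric] of_int_diff[symmetric] by (simp add: abs_mult)
      finally show "2 * pi \<le> norm ((F y - H y) - (F x - H x))" by simp
    qed simp
  qed (use assms in \<open>auto intro: continuous_intros\<close>)
  then obtain c where "\<And>t. F t - H t = c" by (auto simp: constant_on_def)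
  then show thesis using * that by (metis add.commute diff_add_cancel)
qed

lemma has_real_derivative_add_const_iff:
  fixes f :: "real \<Rightarrow> real"
  shows "((\<lambda>s. f s + a) has_real_derivative D) (at t) \<longleftrightarrow> (f has_real_derivative D) (at t)"
  using DERIV_diff[of "\<lambda>s. f s + a" D t UNIV "\<lambda>s. a" 0] DERIV_add[of f D t UNIV "\<lambda>s. a" 0]
  by auto

lemma deriv_add_constant:
  fixes f :: "real \<Rightarrow> real"
  shows "deriv (\<lambda>s. f s + a) = deriv f"
  by (rule ext) (simp add: deriv_def has_real_derivative_add_const_iff)

lemma deriv_periodic:
  fixes f :: "real \<Rightarrow> real"
  assumes "\<And>t. f (t + c) = f t + a"
  shows "deriv f (t + c) = deriv f t"
  by (simp add: deriv_def DERIV_shift assms has_real_derivative_add_const_iff)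

lemma continuous_periodic_bounded:
  fixes f :: "real \<Rightarrow> real"
  assumes "continuous_on UNIV f" "\<And>t k::int. f (t + 2 * pi * of_int k) = f t"
  obtains B where "\<And>t. \<bar>f t\<bar> \<le> B"
proof -
  have "compact (f ` {0..2 * pi})"
    using assms(1) continuous_on_subset compact_continuous_image compact_Icc by (metis top_greatest)
  then obtain B where B: "\<And>t. t \<in> {0..2 * pi} \<Longrightarrow> \<bar>f t\<bar> \<le> B"
    using compact_imp_bounded bounded_iff by (metis (no_types) imageI real_norm_def)
  have "\<bar>f t\<bar> \<le> B" for t
  proof -
    obtain k where "t + 2 * pi * of_int k \<in> {0..<2 * pi}" by (rule reduce_mod_2pi)
    then show ?thesis using B[of "t + 2 * pi * of_int k"] by (simp add: assms(2))
  qed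
  then show thesis by (rule that)
qed

lemma is_lift_comp:
  assumes "is_lift F f" "is_lift H g"
  shows "is_lift (\<lambda>t. F (H t)) (\<lambda>x. f (g x))"
  using assms continuous_on_compose2[of UNIV F UNIV H] by (auto simp: is_lift_def)

lemma is_lift_cong: "is_lift F f \<Longrightarrow> (\<And>x. x \<in> S1 \<Longrightarrow> f x = g x) \<Longrightarrow> is_lift F g"
  by (simp add: is_lift_def)

lemma is_lift_shift:
  assumes "is_lift F f"
  shows "is_lift (\<lambda>t. F (t + 2 * pi * of_int k)) f"
proof -
  have "is_lift (\<lambda>t. t + 2 * pi * of_int k) (\<lambda>x. x)"
    by (auto simp: is_lift_def cis_add_2pi intro!: continuous_intros)
  from is_lift_comp[OF assms this] show ?thesis .
qed

lemma is_lift_add: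
  "is_lift F f \<Longrightarrow> is_lift (\<lambda>t. F t + 2 * pi * of_int k) f"
  by (auto simp: is_lift_def cis_add_2pi intro!: continuous_intros)

lemma is_lift_unique:
  assumes "is_lift F f" "is_lift H f"
  obtains k :: int where "F = (\<lambda>t. H t + 2 * pi * of_int k)"
  using cis_equal_lifts_differ_by_constant[of F H] assms unfolding is_lift_def by metis

lemma C_k_2D:
  assumes "C_k 2 F"
  shows "(F has_real_derivative deriv F t) (at t)"
    and "(deriv F has_real_derivative deriv (deriv F) t) (at t)"
    and "continuous_on UNIV (deriv (deriv F))"
proof -
  have "\<forall>j<2. \<forall>t. (deriv ^^ j) F differentiable (at t)" using assms by (simp add: C_k_def)
  from this[rule_format, of 0] this[rule_format, of 1]
  show "(F has_real_derivative deriv F t) (at t)"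
    "(deriv F has_real_derivative deriv (deriv F) t) (at t)"
    by (auto simp: DERIV_deriv_iff_real_differentiable)
  show "continuous_on UNIV (deriv (deriv F))" using assms by (simp add: C_k_def numeral_2_eq_2)
qed

context
  fixes f F assumes f: "f \<in> Diff_plus 2" and F: "is_lift F f"
begin

text \<open>The definition provides one smooth lift; any other differs from it by a constant and has
  the same derivatives.\<close>

lemma lift_C2:
  shows "(F has_real_derivative deriv F t) (at t)"
    and "(deriv F has_real_derivative deriv (deriv F) t) (at t)"
    and "continuous_on UNIV (deriv (deriv F))"
proof -
  obtain H where H: "is_lift H f" "C_k 2 H" using f by (auto simp: Diff_plus_def C_k_circle_map_def)
  obtain k :: int where k: "F = (\<lambda>t. H t + 2 * pi * of_int k)" using is_lift_unique[OF F H(1)] .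
  have "deriv F = deriv H" unfolding k by (rule deriv_add_constant)
  moreover have "(F has_real_derivative deriv H t) (at t)"
    unfolding k using C_k_2D(1)[OF H(2)] by (auto intro!: derivative_eq_intros)
  ultimately show "(F has_real_derivative deriv F t) (at t)"
    "(deriv F has_real_derivative deriv (deriv F) t) (at t)"
    "continuous_on UNIV (deriv (deriv F))"
    using C_k_2D(2,3)[OF H(2)] by auto
qed

lemma lift_strict_mono: "strict_mono F"
proof -
  obtain H where H: "is_lift H f" "strict_mono H" using f by (auto simp: Diff_plus_def orientation_preserving_def)
  obtain k :: int where k: "F = (\<lambda>t. H t + 2 * pi * of_int k)" using is_lift_unique[OF F H(1)] .
  show ?thesis unfolding k using H(2) by (simp add: strict_mono_def)
qed

text \<open>A lift of the inverse map inverts \<open>F\<close> up to a deck translation. The chain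
  rule then shows that the derivative of \<open>F\<close> does not vanish, and monotonicity fixes
  its sign.\<close>

lemma lift_inverse:
  obtains H where "is_lift H (inv_into S1 f)" "\<And>t. F (H t) = t" "\<And>t. H (F t) = t" "\<And>t. deriv F t > 0"
proof -
  obtain K where K: "is_lift K (inv_into S1 f)" "C_k 2 K"
    using f by (auto simp: Diff_plus_def C_k_circle_map_def)
  have surj: "f ` S1 = S1" using f by (auto simp: Diff_plus_def Bij_def bij_betw_def)
  have "cis (F (K t)) = cis t" for t
  proof -
    have "cis (F (K t)) = f (inv_into S1 f (cis t))" using F K(1) by (simp add: is_lift_def)
    also have "\<dots> = cis t" using surj by (intro f_inv_into_f) simp
    finally show ?thesis .
  qed
  moreover have "continuous_on UNIV (\<lambda>t. F (K t))"
    using F K(1) continuous_on_compose2[of UNIV F UNIV K] by (auto simp: is_lift_def)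
  ultimately obtain k :: int where k: "\<And>t. F (K t) = t + 2 * pi * of_int k"
    using cis_equal_lifts_differ_by_constant[of "\<lambda>t. F (K t)" "\<lambda>t. t"] continuous_on_id by blast
  have inj: "F s = F t \<Longrightarrow> s = t" for s t using lift_strict_mono strict_mono_eq by blast
  \<comment> \<open>Shifting the argument cancels the translation, giving an exact right inverse;
    injectivity of \<open>F\<close> makes it two-sided.\<close>
  define H where "H t = K (t + 2 * pi * of_int (- k))" for t
  have FH: "F (H t) = t" for t by (simp add: H_def k)
  have HF: "H (F t) = t" for t by (rule inj) (simp add: FH)
  have lift: "is_lift H (inv_into S1 f)" unfolding H_def by (rule is_lift_shift[OF K(1)])
  have "deriv F t > 0" for t
  proof -
    have "(H has_real_derivative deriv K (F t + 2 * pi * of_int (- k))) (at (F t))"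
      unfolding H_def[abs_def] DERIV_shift[symmetric] by (rule C_k_2D(1)[OF K(2)])
    then have "((\<lambda>s. F (H s)) has_real_derivative deriv F (H (F t)) * deriv K (F t + 2 * pi * of_int (- k))) (at (F t))"
      by (rule DERIV_chain2[OF lift_C2(1)])
    moreover have "((\<lambda>s. F (H s)) has_real_derivative 1) (at (F t))" by (simp add: FH)
    ultimately have "deriv F t * deriv K (F t + 2 * pi * of_int (- k)) = 1"
      using DERIV_unique HF by metis
    moreover have "deriv F t \<ge> 0"
    proof (rule mono_on_imp_deriv_nonneg)
      show "mono_on UNIV F" using lift_strict_mono by (simp add: strict_mono_mono mono_imp_mono_on)
    qed (use lift_C2(1) in auto)
    ultimately show ?thesis by (cases "deriv F t = 0") auto
  qed
  then show thesis using that[of H] lift FH HF by blast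
qed

end

section \<open>The Cantor set contains no arc\<close>

text \<open>No stage after the first contains \<open>1 / 2\<close>, so the interval lies in one of
  the two scaled copies; rescaling by 3 leads to the previous stage.\<close>

lemma interval_subset_cantor_step:
  fixes a b :: real
  assumes "{a..b} \<subseteq> ((\<lambda>A. (\<lambda>x. x / 3) ` A \<union> (\<lambda>x. (x + 2) / 3) ` A) ^^ n) {0..1}" "a \<le> b"
  shows "b - a \<le> (1 / 3) ^ n"
  using assms
proof (induction n arbitrary: a b)
  case 0
  then show ?case by auto
next
  case (Suc n)
  define T where "T = (\<lambda>A::real set. (\<lambda>x. x / 3) ` A \<union> (\<lambda>x. (x + 2) / 3) ` A)"
  have unit: "(T ^^ k) {0..1} \<subseteq> {0..1}" for k
    by (induction k) (fastforce simp: T_def)+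
  define C where "C = (T ^^ n) {0..1}"
  have sub: "{a..b} \<subseteq> T C" using Suc.prems by (simp add: C_def T_def)
  have C: "C \<subseteq> {0..1}" using unit by (simp add: C_def)
  have IH: "d - c \<le> (1 / 3) ^ n" if "{c..d} \<subseteq> C" "c \<le> d" for c d
    using Suc.IH[of c d] that by (simp add: C_def T_def)
  have "\<not> (a \<le> 1 / 2 \<and> 1 / 2 \<le> b)"
  proof
    assume "a \<le> 1 / 2 \<and> 1 / 2 \<le> b"
    then have "1 / 2 \<in> T C" using sub by auto
    then show False using C by (force simp: T_def)
  qed
  then consider "b < 1 / 2" | "1 / 2 < a" using Suc.prems(2) by linarith
  then show ?case
  proof cases
    case 1
    have "{3 * a..3 * b} \<subseteq> C"
    proof
      fix x assume "x \<in> {3 * a..3 * b}"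
      then have "x / 3 \<in> {a..b}" by auto
      then have "x / 3 \<in> T C" "x / 3 < 1 / 2" using sub 1 by auto
      then show "x \<in> C" using C by (force simp: T_def)
    qed
    then show ?thesis using IH[of "3 * a" "3 * b"] Suc.prems(2) by simp
  next
    case 2
    have "{3 * a - 2..3 * b - 2} \<subseteq> C"
    proof
      fix x assume "x \<in> {3 * a - 2..3 * b - 2}"
      then have "(x + 2) / 3 \<in> {a..b}" by auto
      then have "(x + 2) / 3 \<in> T C" "(x + 2) / 3 > 1 / 2" using sub 2 by auto
      then show "x \<in> C" using C by (force simp: T_def)
    qed
    then show ?thesis using IH[of "3 * a - 2" "3 * b - 2"] Suc.prems(2) by simp
  qed
qed

lemma connected_subset_cantor_set:
  assumes "connected A" "A \<subseteq> cantor_set" "a \<in> A" "b \<in> A"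
  shows "a = b"
proof -
  have "\<not> x < y" if "x \<in> A" "y \<in> A" for x y
  proof
    assume "x < y"
    have "{x..y} \<subseteq> cantor_set"
      using connected_contains_Icc[OF assms(1) that] assms(2) by blast
    then have "y - x \<le> (1 / 3) ^ n" for n
      using \<open>x < y\<close> by (intro interval_subset_cantor_step) (auto simp: cantor_set_def)
    moreover obtain n where "(1 / 3) ^ n < y - x"
      using real_arch_pow_inv[of "y - x" "1 / 3"] \<open>x < y\<close> by auto
    ultimately show False by (metis not_le)
  qed
  then show ?thesis using assms(3,4) by (meson linorder_neqE)
qed

text \<open>A homeomorphism would send an arc in \<open>A\<close> to a connected part of the Cantor
  set, which is a single point.\<close>

lemma interior_lifted_cantor:
  assumes "A homeomorphic cantor_set"
  shows "interior {t. cis t \<in> A} = {}"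
proof (rule ccontr)
  assume "interior {t. cis t \<in> A} \<noteq> {}"
  then obtain t e where e: "e > 0" "cball t e \<subseteq> {t. cis t \<in> A}"
    by (auto simp: mem_interior_cball)
  \<comment> \<open>The bound 1, being below \<open>2 * pi\<close>, keeps the end points of the arc
    distinct on the circle.\<close>
  define d where "d = min e 1"
  obtain f g where fg: "homeomorphism A cantor_set f g" using assms by (auto simp: homeomorphic_def)
  have sub: "cis ` {t..t + d} \<subseteq> A" using e by (auto simp: d_def dist_real_def subset_iff)
  have "continuous_on (cis ` {t..t + d}) f"
    using fg sub continuous_on_subset by (auto simp: homeomorphism_def)
  then have "connected (f ` cis ` {t..t + d})"
    by (intro connected_continuous_image continuous_intros) auto
  moreover have "f ` cis ` {t..t + d} \<subseteq> cantor_set" using fg sub by (auto simp: homeomorphism_def)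
  moreover have "t \<in> {t..t + d}" "t + d \<in> {t..t + d}" using e by (auto simp: d_def)
  ultimately have "f (cis t) = f (cis (t + d))"
    by (intro connected_subset_cantor_set[of "f ` cis ` {t..t + d}"]) auto
  moreover have "cis t \<in> A" "cis (t + d) \<in> A" using sub e by (auto simp: d_def)
  ultimately have "cis t = cis (t + d)" using fg by (metis homeomorphism_apply1)
  then obtain k :: int where "t = t + d + 2 * pi * of_int k" unfolding cis_eq_iff by blast
  then have k: "d = 2 * pi * of_int (- k)" by simp
  have "0 < d" "d < 2 * pi * 1" using e pi_gt3 by (auto simp: d_def)
  then have "pi * 0 < pi * real_of_int (- k)" "pi * real_of_int (- k) < pi * 1" unfolding k by auto
  then have "0 < real_of_int (- k)" "real_of_int (- k) < 1"
    unfolding mult_less_cancel_left_pos[OF pi_gt_zero] by blast+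
  then have "0 < - k" "- k < 1" by (simp_all only: of_int_0_less_iff of_int_less_1_iff)
  then show False by linarith
qed

section \<open>The theorem\<close>

text \<open>\<open>X n\<close> collects the products obtained in \<open>n\<close> rounds of
  multiplication. The layers increase, so two factors always lie in a common one.\<close>

lemma countable_generate:
  assumes "countable S"
  shows "countable (generate K S)"
proof -
  define X where "X = rec_nat ({\<one>\<^bsub>K\<^esub>} \<union> S \<union> (\<lambda>h. inv\<^bsub>K\<^esub> h) ` S)
     (\<lambda>_ A. A \<union> (\<lambda>(a, b). a \<otimes>\<^bsub>K\<^esub> b) ` (A \<times> A))"
  have X0: "X 0 = {\<one>\<^bsub>K\<^esub>} \<union> S \<union> (\<lambda>h. inv\<^bsub>K\<^esub> h) ` S"
    and XS: "\<And>n. X (Suc n) = X n \<union> (\<lambda>(a, b). a \<otimes>\<^bsub>K\<^esub> b) ` (X n \<times> X n)"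
    by (simp_all add: X_def)
  have count: "countable (X n)" for n
    by (induction n) (auto simp: X0 XS assms)
  have mono: "X i \<subseteq> X j" if "i \<le> j" for i j
    using that by (rule lift_Suc_mono_le[rotated]) (auto simp: XS)
  have "g \<in> (\<Union>n. X n)" if "g \<in> generate K S" for g
    using that
  proof induction
    case one
    then show ?case using X0 by blast
  next
    case (incl h)
    then show ?case using X0 by blast
  next
    case (inv h)
    then show ?case using X0 by blast
  next
    case (eng a b)
    then obtain i j where "a \<in> X i" "b \<in> X j" by blast
    then have "a \<in> X (max i j)" "b \<in> X (max i j)"
      using mono[of i "max i j"] mono[of j "max i j"] by auto
    then have "a \<otimes>\<^bsub>K\<^esub> b \<in> X (Suc (max i j))" by (force simp: XS)
    then show ?case by blast
  qed
  then have "generate K S \<subseteq> (\<Union>n. X n)" by blast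
  then show ?thesis by (rule countable_subset) (simp add: count)
qed

text \<open>In the angle coordinate the curve is \<open>cis (F (t + s))\<close>, with velocity of
  norm \<open>\<bar>D\<bar>\<close>; positivity of \<open>D\<close> removes the absolute
  value.\<close>

lemma metric_deriv_cis:
  assumes "is_lift F f" "(F has_real_derivative D) (at t)" "D > 0" "\<And>x. x \<in> S1 \<Longrightarrow> m x > 0"
  shows "metric_deriv m f (cis t) = sqrt (m (cis (F t))) / sqrt (m (cis t)) * D"
proof -
  have "((\<lambda>s. F (t + s)) has_real_derivative D) (at 0)"
    using assms(2) DERIV_shift[of F D 0 t] by (simp add: add.commute)
  then have "((\<lambda>s. cis (F (t + s))) has_vector_derivative (D *\<^sub>R (\<i> * cis (F t)))) (at 0)"
    unfolding has_vector_derivative_def has_field_derivative_def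
    using has_derivative_cis[of "\<lambda>s. F (t + s)" "(*) D" 0 UNIV] by (simp add: mult_ac)
  moreover have "(\<lambda>s. f (cis t * cis s)) = (\<lambda>s. cis (F (t + s)))"
    using assms(1) by (simp add: cis_mult is_lift_def)
  ultimately have "vector_derivative (\<lambda>s. f (cis t * cis s)) (at 0) = D *\<^sub>R (\<i> * cis (F t))"
    using vector_derivative_at by metis
  moreover have "f (cis t) = cis (F t)" using assms(1) by (simp add: is_lift_def)
  ultimately show ?thesis using assms(3) by (simp add: metric_deriv_def tangent_norm_def norm_mult)
qed

lemma inj_on_cis: "inj_on cis {0..<2 * pi}"
proof (rule inj_onI)
  fix s t assume st: "s \<in> {0..<2 * pi}" "t \<in> {0..<2 * pi}" "cis s = cis t"
  then obtain k :: int where k: "s = t + 2 * pi * of_int k" unfolding cis_eq_iff by blast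
  have "0 \<le> s" "s < 2 * pi" "0 \<le> t" "t < 2 * pi" using st by auto
  then have "2 * pi * (- 1) < 2 * pi * of_int k" "2 * pi * of_int k < 2 * pi * 1"
    using k by linarith+
  moreover have "0 < 2 * pi" by simp
  ultimately have "- 1 < real_of_int k" "real_of_int k < 1"
    unfolding mult_less_cancel_left_pos[OF \<open>0 < 2 * pi\<close>] by blast+
  then have "k = 0" by linarith
  then show "s = t" using k by simp
qed

text \<open>The derivative of \<open>ln (deriv F)\<close> is the quotient of the second by the first
  derivative, which is continuous and periodic, hence bounded.\<close>

lemma lift_ln_deriv_lipschitz:
  assumes f: "f \<in> Diff_plus 2" and F: "is_lift F f"
  shows "\<exists>K. \<forall>u v. \<bar>ln (deriv F u) - ln (deriv F v)\<bar> \<le> K * \<bar>u - v\<bar>"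
proof -
  have pos: "deriv F t > 0" for t using lift_inverse[OF f F] by blast
  have per1: "deriv F (t + 2 * pi * of_int k) = deriv F t" for t k
  proof -
    obtain j :: int where "(\<lambda>t. F (t + 2 * pi * of_int k)) = (\<lambda>t. F t + 2 * pi * of_int j)"
      using is_lift_unique[OF is_lift_shift[OF F] F] .
    then show ?thesis by (intro deriv_periodic[where a = "2 * pi * of_int j"]) meson
  qed
  have per2: "deriv (deriv F) (t + 2 * pi * of_int k) = deriv (deriv F) t" for t k
    by (rule deriv_periodic[where a = 0]) (simp add: per1)
  define g where "g t = deriv (deriv F) t / deriv F t" for t
  have "continuous_on UNIV (deriv F)"
    using lift_C2(2)[OF f F] DERIV_isCont continuous_at_imp_continuous_on by blast
  then have "continuous_on UNIV g"
    unfolding g_def using pos lift_C2(3)[OF f F] by (intro continuous_intros) (auto simp: less_imp_neq[symmetric])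
  then obtain B where B: "\<And>t. \<bar>g t\<bar> \<le> B"
    by (rule continuous_periodic_bounded) (auto simp: g_def per1 per2)
  have der: "((\<lambda>t. ln (deriv F t)) has_real_derivative g t) (at t)" for t
    unfolding g_def by (rule derivative_eq_intros lift_C2(2)[OF f F] pos refl)+ simp
  have "\<bar>ln (deriv F u) - ln (deriv F v)\<bar> \<le> B * \<bar>u - v\<bar>" for u v
  proof -
    obtain z where "ln (deriv F u) - ln (deriv F v) = g z * (u - v)"
      by (rule mean_value_closed_segment[OF der, of v u])
    then show ?thesis by (simp add: abs_mult mult_right_mono B)
  qed
  then show ?thesis by blast
qed

theorem theorem4:
  fixes m :: "complex \<Rightarrow> real"
    and G :: "(complex \<Rightarrow> complex) set"
    and \<Lambda> :: "complex set"
  assumes "riemannian_metric m"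
    and "subgroup G (BijGroup S1)"
    and "finitely_generated (BijGroup S1) G"
    and "G \<subseteq> Diff_plus 2"
    and "exceptional_minimal_set G \<Lambda>"
    and "property_Lambda_star m G \<Lambda>"
  shows "finite (\<Lambda> \<inter> NE m G)
    \<and> (\<forall>x\<in>\<Lambda>. x \<notin> {g y | g y. g \<in> G \<and> y \<in> NE m G} \<longrightarrow>
          \<not> bounded {metric_deriv m g x | g. g \<in> G})
    \<and> \<Lambda> \<in> null_sets circle_lebesgue"
proof -
  define \<Gamma> where "\<Gamma> = {F. \<exists>g\<in>G. is_lift F g}"
  define L where "L = {t. cis t \<in> \<Lambda>}"
  define w where "w t = sqrt (m (cis t))" for t
  have m_pos: "m x > 0" if "x \<in> S1" for x using assms(1) that by (simp add: riemannian_metric_def)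
  have diff: "g \<in> Diff_plus 2" if "g \<in> G" for g using assms(4) that by blast
  have Bij: "g \<in> Bij S1" if "g \<in> G" for g using diff[OF that] by (simp add: Diff_plus_def)
  \<comment> \<open>The inverse in \<open>BijGroup S1\<close> is cut off outside the circle, so it
    agrees with \<open>inv_into\<close> on \<open>S1\<close>; a lift sees just these values.\<close>
  have inv_lift: "\<exists>h\<in>G. \<forall>x\<in>S1. h x = inv_into S1 g x" if "g \<in> G" for g
    using subgroup.m_inv_closed[OF assms(2) that] inv_BijGroup[OF Bij[OF that]]
    by (intro bexI[of _ "inv\<^bsub>BijGroup S1\<^esub> g"]) auto
  have has_lift: "\<exists>F\<in>\<Gamma>. is_lift F g" if "g \<in> G" for g
    using diff[OF that] that by (auto simp: \<Gamma>_def Diff_plus_def orientation_preserving_def)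
  have \<Lambda>: "\<Lambda> \<noteq> {}" "\<Lambda> \<subseteq> S1" "closed \<Lambda>" "\<And>g. g \<in> G \<Longrightarrow> g ` \<Lambda> = \<Lambda>" "\<Lambda> homeomorphic cantor_set"
    using assms(5) by (auto simp: exceptional_minimal_set_def closed_invariant_def)
  have mem_\<Lambda>: "g x \<in> \<Lambda> \<longleftrightarrow> x \<in> \<Lambda>" if g: "g \<in> G" and x: "x \<in> S1" for g x
  proof
    have inj: "inj_on g S1" using Bij[OF g] by (simp add: Bij_def bij_betw_def)
    assume "g x \<in> \<Lambda>"
    then obtain y where "y \<in> \<Lambda>" "g x = g y" using \<Lambda>(4)[OF g] by blast
    then show "x \<in> \<Lambda>" using inj_onD[OF inj, of x y] x \<Lambda>(2) by blast
  qed (use \<Lambda>(4)[OF g] in blast)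
  have C0: "continuous_on UNIV (\<lambda>t. m (cis t))"
    using assms(1) by (auto simp: riemannian_metric_def C_k_def dest!: spec[of _ 0])

  \<comment> \<open>The action of \<open>G\<close> lifted to the line\<close>
  interpret lifted_circle_action \<Gamma> w L
  proof
    fix F H assume F: "F \<in> \<Gamma>"
    then obtain f where f: "f \<in> G" "is_lift F f" by (auto simp: \<Gamma>_def)
    note fD = diff[OF f(1)]
    show "(\<lambda>t. F (H t)) \<in> \<Gamma>" if "H \<in> \<Gamma>"
    proof -
      obtain h where h: "h \<in> G" "is_lift H h" using \<open>H \<in> \<Gamma>\<close> by (auto simp: \<Gamma>_def)
      have "f \<otimes>\<^bsub>BijGroup S1\<^esub> h \<in> G" using subgroup.m_closed[OF assms(2) f(1) h(1)] .
      moreover have "is_lift (\<lambda>t. F (H t)) (f \<otimes>\<^bsub>BijGroup S1\<^esub> h)"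
        by (rule is_lift_cong[OF is_lift_comp[OF f(2) h(2)]])
          (simp add: BijGroup_def Bij[OF f(1)] Bij[OF h(1)] compose_def)
      ultimately show ?thesis by (auto simp: \<Gamma>_def)
    qed
    show "\<exists>H\<in>\<Gamma>. (\<forall>t. F (H t) = t) \<and> (\<forall>t. H (F t) = t)"
    proof -
      obtain K where K: "is_lift K (inv_into S1 f)" "\<And>t. F (K t) = t" "\<And>t. K (F t) = t"
        using lift_inverse[OF fD f(2)] by metis
      obtain h where "h \<in> G" "\<And>x. x \<in> S1 \<Longrightarrow> h x = inv_into S1 f x" using inv_lift[OF f(1)] by blast
      then have "K \<in> \<Gamma>" using is_lift_cong[OF K(1), of h] by (auto simp: \<Gamma>_def)
      then show ?thesis using K by blast
    qed
    show "(F has_real_derivative deriv F t) (at t)" for t by (rule lift_C2(1)[OF fD f(2)])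
    show "deriv F t > 0" for t using lift_inverse[OF fD f(2)] by blast
    show "\<exists>K. \<forall>u v. \<bar>ln (deriv F u) - ln (deriv F v)\<bar> \<le> K * \<bar>u - v\<bar>"
      by (rule lift_ln_deriv_lipschitz[OF fD f(2)])
    show "F t \<in> L \<longleftrightarrow> t \<in> L" for t
      using mem_\<Lambda>[OF f(1), of "cis t"] f(2) by (simp add: L_def is_lift_def)
  next
    have "is_lift (\<lambda>t. t + 2 * pi * of_int k) \<one>\<^bsub>BijGroup S1\<^esub>" for k
      by (auto simp: BijGroup_def is_lift_def cis_add_2pi intro!: continuous_intros)
    then show "(\<lambda>t. t + 2 * pi * of_int k) \<in> \<Gamma>" for k
      using subgroup.one_closed[OF assms(2)] by (auto simp: \<Gamma>_def)
    show "continuous_on UNIV w" unfolding w_def by (intro continuous_intros C0)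
    show "w t > 0" for t by (simp add: w_def m_pos)
    show "w (t + 2 * pi * of_int k) = w t" for t k by (simp add: w_def cis_add_2pi)
    show "closed L" unfolding L_def
      using \<Lambda>(3) closed_vimage[of \<Lambda> cis] continuous_on_cis[OF continuous_on_id, of UNIV]
      by (simp add: vimage_def)
    show "interior L = {}" unfolding L_def by (rule interior_lifted_cantor[OF \<Lambda>(5)])
  qed
  have metric: "metric_deriv m g (cis t) = expansion F t" if "g \<in> G" "is_lift F g" for g F t
  proof -
    have "F \<in> \<Gamma>" using that by (auto simp: \<Gamma>_def)
    then show ?thesis unfolding expansion_def w_def
      by (intro metric_deriv_cis that(2) has_deriv deriv_pos m_pos)
  qed
  \<comment> \<open>Every \<open>g\<close> has a lift, and all lifts of \<open>g\<close> have the
    same expansion factor, so quantifying over \<open>\<Gamma>\<close> or over \<open>G\<close>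
    amounts to the same.\<close>
  have NE_iff: "cis t \<in> NE m G \<longleftrightarrow> t \<in> nonexp" for t
  proof -
    have "(\<forall>g\<in>G. metric_deriv m g (cis t) \<le> 1) \<longleftrightarrow> (\<forall>F\<in>\<Gamma>. expansion F t \<le> 1)"
    proof (intro iffI ballI)
      fix F assume "\<forall>g\<in>G. metric_deriv m g (cis t) \<le> 1" "F \<in> \<Gamma>"
      then show "expansion F t \<le> 1" unfolding \<Gamma>_def using metric by fastforce
    next
      fix g assume *: "\<forall>F\<in>\<Gamma>. expansion F t \<le> 1" "g \<in> G"
      obtain F where "F \<in> \<Gamma>" "is_lift F g" using has_lift[OF *(2)] by blast
      then show "metric_deriv m g (cis t) \<le> 1" using * metric by simp
    qed
    then show ?thesis by (simp add: NE_def nonexp_def)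
  qed
  \<comment> \<open>A lift of a map fixing \<open>cis x\<close> may move \<open>x\<close> by a
    multiple of \<open>2 * pi\<close>; subtracting it gives a lift with a true fixed point.\<close>
  have adjust: "\<exists>F\<in>\<Gamma>. F x = x \<and> is_lift F g" if g: "g \<in> G" "g (cis x) = cis x" for g x
  proof -
    obtain F where F: "is_lift F g" using has_lift[OF g(1)] by blast
    then have "cis (F x) = cis x" using g(2) by (simp add: is_lift_def)
    then obtain k :: int where k: "F x = x + 2 * pi * of_int k" unfolding cis_eq_iff by blast
    have "is_lift (\<lambda>t. F t + 2 * pi * of_int (- k)) g" by (rule is_lift_add[OF F])
    then show ?thesis using k g(1)
      by (intro bexI[of _ "\<lambda>t. F t + 2 * pi * of_int (- k)"]) (auto simp: \<Gamma>_def)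
  qed
  interpret lifted_star_action \<Gamma> w L
  proof
    fix x assume "x \<in> L" "x \<in> nonexp"
    then have "cis x \<in> \<Lambda> \<inter> NE m G" using NE_iff by (simp add: L_def)
    then obtain gm gp \<epsilon> where g: "gm \<in> G" "gp \<in> G" "gp (cis x) = cis x" "gm (cis x) = cis x" "\<epsilon> > 0"
      "\<forall>s\<in>{0<..<\<epsilon>}. gp (cis x * cis s) \<noteq> cis x * cis s"
      "\<forall>s\<in>{0<..<\<epsilon>}. gm (cis x * cis (- s)) \<noteq> cis x * cis (- s)"
      using assms(6) unfolding property_Lambda_star_def by blast
    obtain F where F: "F \<in> \<Gamma>" "F x = x" "is_lift F gp" using adjust[OF g(2,3)] by blast
    obtain H where H: "H \<in> \<Gamma>" "H x = x" "is_lift H gm" using adjust[OF g(1,4)] by blast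
    have "F (x + s) \<noteq> x + s" if "s \<in> {0<..<\<epsilon>}" for s
      using g(6)[rule_format, OF that] F(3) unfolding is_lift_def cis_mult by metis
    moreover have "H (x - s) \<noteq> x - s" if "s \<in> {0<..<\<epsilon>}" for s
      using g(7)[rule_format, OF that] H(3) unfolding is_lift_def cis_mult by (metis uminus_add_conv_diff add.commute)
    ultimately show "\<exists>F\<in>\<Gamma>. \<exists>H\<in>\<Gamma>. F x = x \<and> H x = x \<and>
        (\<exists>\<epsilon>>0. (\<forall>s\<in>{0<..<\<epsilon>}. F (x + s) \<noteq> x + s) \<and> (\<forall>s\<in>{0<..<\<epsilon>}. H (x - s) \<noteq> x - s))"
      using F(1,2) H(1,2) g(5) by blast
  qed
  have cis_ex: "\<exists>t\<in>{0..<2 * pi}. x = cis t" if x: "x \<in> S1" for x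
  proof -
    have "norm x = 1" using x by simp
    then obtain s where "x = cis s" by (metis cis_Arg norm_zero sgn_eq zero_neq_one div_by_1 of_real_1)
    moreover obtain k where "s + 2 * pi * of_int k \<in> {0..<2 * pi}" by (rule reduce_mod_2pi)
    ultimately show ?thesis using cis_add_2pi by metis
  qed

  \<comment> \<open>Finiteness of the non-expandable points in \<open>\<Lambda>\<close>\<close>
  have "\<Lambda> \<inter> NE m G \<subseteq> cis ` (L \<inter> nonexp \<inter> {0..2 * pi})"
  proof
    fix x assume x: "x \<in> \<Lambda> \<inter> NE m G"
    then obtain t where "t \<in> {0..<2 * pi}" "x = cis t" using cis_ex[of x] \<Lambda>(2) by blast
    then show "x \<in> cis ` (L \<inter> nonexp \<inter> {0..2 * pi})" using x NE_iff by (auto simp: L_def)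
  qed
  then have fin: "finite (\<Lambda> \<inter> NE m G)" using finite_nonexp finite_surj by blast
  have orbit: "\<exists>g\<in>G. cis t = g (cis (F t))" if F: "F \<in> \<Gamma>" for F t
  proof -
    obtain f where f: "f \<in> G" "is_lift F f" using F by (auto simp: \<Gamma>_def)
    obtain h where h: "h \<in> G" "\<And>x. x \<in> S1 \<Longrightarrow> h x = inv_into S1 f x" using inv_lift[OF f(1)] by blast
    have "inj_on f S1" using Bij[OF f(1)] by (simp add: Bij_def bij_betw_def)
    then have "inv_into S1 f (f (cis t)) = cis t" by (rule inv_into_f_f) simp
    then have "h (cis (F t)) = cis t" using h(2)[of "cis (F t)"] f(2) by (simp add: is_lift_def)
    then show ?thesis using h(1) by metis
  qed

  \<comment> \<open>Unbounded derivatives off the orbit of \<open>NE\<close>\<close>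
  have unbounded: "\<not> bounded {metric_deriv m g x | g. g \<in> G}"
    if x: "x \<in> \<Lambda>" "x \<notin> {g y | g y. g \<in> G \<and> y \<in> NE m G}" for x
  proof
    assume "bounded {metric_deriv m g x | g. g \<in> G}"
    then obtain M where M: "\<And>g. g \<in> G \<Longrightarrow> \<bar>metric_deriv m g x\<bar> \<le> M"
      by (auto simp: bounded_iff)
    obtain t where t: "x = cis t" using cis_ex x(1) \<Lambda>(2) by blast
    have "t \<notin> exceptional_points"
    proof
      assume "t \<in> exceptional_points"
      then obtain F where F: "F \<in> \<Gamma>" "F t \<in> nonexp" by (auto simp: exceptional_points_def)
      then have "cis (F t) \<in> NE m G" using NE_iff by blast
      then show False using orbit[OF F(1), of t] x(2) t by blast
    qed
    then have "t \<in> L - exceptional_points" using x(1) t by (simp add: L_def)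
    then obtain F where F: "F \<in> \<Gamma>" "M < expansion F t" using expansion_unbounded by blast
    then obtain g where "g \<in> G" "is_lift F g" by (auto simp: \<Gamma>_def)
    then show False using M[of g] metric[of g F t] F(2) t by simp
  qed

  \<comment> \<open>Countability of the exceptional points and measure zero\<close>
  have "countable G" using assms(3) countable_generate countable_finite by (auto simp: finitely_generated_def)
  then have "countable ((\<lambda>(g, y). g y) ` (G \<times> (\<Lambda> \<inter> NE m G)))"
    using fin by (intro countable_image countable_SIGMA) (auto simp: countable_finite)
  moreover have "cis ` (exceptional_points \<inter> L \<inter> {0..<2 * pi}) \<subseteq> (\<lambda>(g, y). g y) ` (G \<times> (\<Lambda> \<inter> NE m G))"
  proof
    fix x assume "x \<in> cis ` (exceptional_points \<inter> L \<inter> {0..<2 * pi})"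
    then obtain t F where t: "x = cis t" "t \<in> L" "F \<in> \<Gamma>" "F t \<in> nonexp" by (auto simp: exceptional_points_def)
    then have "cis (F t) \<in> \<Lambda> \<inter> NE m G" using NE_iff L_invariant[of F t] by (simp add: L_def)
    moreover obtain g where "g \<in> G" "x = g (cis (F t))" using orbit[OF t(3)] t(1) by blast
    ultimately show "x \<in> (\<lambda>(g, y). g y) ` (G \<times> (\<Lambda> \<inter> NE m G))" by force
  qed
  ultimately have "countable (cis ` (exceptional_points \<inter> L \<inter> {0..<2 * pi}))" by (rule countable_subset[rotated])
  moreover have "inj_on cis (exceptional_points \<inter> L \<inter> {0..<2 * pi})"
    by (rule inj_on_subset[OF inj_on_cis]) blast
  ultimately have "countable (exceptional_points \<inter> L \<inter> {0..<2 * pi})" using countable_image_inj_eq by blast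
  then have neg: "negligible (L \<inter> {0..<2 * pi})" by (rule negligible_L)
  have borel: "L \<inter> {0..<2 * pi} \<in> sets borel" using L_closed by auto
  \<comment> \<open>Negligibility concerns the completed measure; since the set is Borel it is also
    null for \<open>lborel\<close>, and this passes to the restriction and its image under
    \<open>cis\<close>.\<close>
  have "emeasure lebesgue (L \<inter> {0..<2 * pi}) = 0"
    using neg by (auto simp: negligible_iff_null_sets null_sets_def)
  then have "L \<inter> {0..<2 * pi} \<in> null_sets lborel" using borel by (simp add: null_sets_def main_part_sets)
  then have "L \<inter> {0..<2 * pi} \<in> null_sets (restrict_space lborel {0..<2 * pi})"
    by (subst null_sets_restrict_space) auto
  moreover have "cis -` \<Lambda> \<inter> space (restrict_space lborel {0..<2 * pi}) = L \<inter> {0..<2 * pi}"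
    by (auto simp: L_def space_restrict_space)
  moreover have "cis \<in> measurable (restrict_space lborel {0..<2 * pi}) borel"
    by (intro measurable_restrict_space1) (auto intro!: borel_measurable_continuous_onI continuous_intros)
  ultimately have "\<Lambda> \<in> null_sets circle_lebesgue"
    unfolding circle_lebesgue_def using \<Lambda>(3) by (subst null_sets_distr_iff) auto
  then show ?thesis using fin unbounded by blast
qed

end
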